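(* Let $\Gamma=(G,\sigma)$ be a signed graph on $N$ vertices and $k\in\{1,2,\dots,N\}$. Then at least one of the following holds: (i) $h_1^{\sigma}(\mu_d)\leq 8k\,\lambda_1(\Delta^{\sigma})$; (ii) $h_1^{\sigma}(\mu_d)< 16\sqrt{2}\,k\,\dfrac{\lambda_1(\Delta^{\sigma})}{\sqrt{\lambda_k(\Delta^{\sigma})}}$.
   Context: A signed graph $\Gamma=(G,\sigma)$ consists of a finite simple undirected graph $G=(V,E)$ with $N=|V|$ vertices, positive symmetric edge weights $w_{uv}>0$ for $\{u,v\}\in E$ ($w_{uv}=0$ otherwise), and a signature $\sigma:E\to\{+1,-1\}$; write $\sigma(uv)=\sigma(\{u,v\})$. The degree is $d_u=\sum_v w_{uv}$ (assumed positive). $D=\mathrm{diag}(d_u)$, $A^{\sigma}_{uv}=\sigma(uv)w_{uv}$ for edges and $0$ otherwise, $\Delta^{\sigma}=I-D^{-1}A^{\sigma}$, with eigenvalues $0\le\lambda_1(\Delta^\sigma)\le\cdots\le\lambda_N(\Delta^\sigma)\le2$. For a positive measure $\mu$, $\mathrm{vol}_\mu(S)=\sum_{u\in S}\mu(u)$; $\mu_d(u)=d_u$. For $V_1,V_2\subseteq V$, $|E(V_1,V_2)|=\sum_{u\in V_1}\sum_{v\in V_2}w_{uv}$, $|E^{\pm}(V_1,V_2)|=\sum_{u\in V_1}\sum_{v\in V_2,\sigma(uv)=\pm1}w_{uv}$, $|E^\pm(V_1)|=|E^\pm(V_1,V_1)|$. For disjoint $V_1,V_2$ with $V_1\cup V_2\ne\emptyset$,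 $$\beta^{\sigma}(V_1,V_2)=\frac{2|E^{+}(V_1,V_2)|+|E^-(V_1)|+|E^-(V_2)|+|E(V_1\cup V_2,\overline{V_1\cup V_2})|}{\mathrm{vol}_{\mu}(V_1\cup V_2)},$$ and $h_1^\sigma(\mu)$ is its minimum over all such pairs. *)

theory Defs
  imports "HOL-Analysis.Analysis" "HOL-Computational_Algebra.Computational_Algebra"
begin

(* The vertex set is the whole finite type 'v, so N = CARD('v). Edges are two-element sets,
   which excludes loops and multiple edges. *)

definition wdegree :: "('v::finite \<Rightarrow> 'v \<Rightarrow> real) \<Rightarrow> 'v \<Rightarrow> real" where
  "wdegree w u = (\<Sum>v\<in>UNIV. w u v)"

locale signed_graph =
  fixes E :: "'v::finite set set"
    and w :: "'v \<Rightarrow> 'v \<Rightarrow> real"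
    and \<sigma> :: "'v set \<Rightarrow> int"
  assumes card_edge: "e \<in> E \<Longrightarrow> card e = 2"
    and weight_sym: "w u v = w v u"
    and weight_pos: "{u, v} \<in> E \<Longrightarrow> w u v > 0"
    and weight_zero: "{u, v} \<notin> E \<Longrightarrow> w u v = 0"
    and signature: "e \<in> E \<Longrightarrow> \<sigma> e = 1 \<or> \<sigma> e = - 1"
    and wdegree_pos: "wdegree w u > 0"

definition degree_matrix :: "('v::finite \<Rightarrow> 'v \<Rightarrow> real) \<Rightarrow> real^'v^'v" where
  "degree_matrix w = (\<chi> u v. if u = v then wdegree w u else 0)"

definition signed_adjacency ::
  "'v::finite set set \<Rightarrow> ('v \<Rightarrow> 'v \<Rightarrow> real) \<Rightarrow> ('v set \<Rightarrow> int) \<Rightarrow> real^'v^'v" where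
  "signed_adjacency E w \<sigma> =
     (\<chi> u v. if {u, v} \<in> E then real_of_int (\<sigma> {u, v}) * w u v else 0)"

definition signed_laplacian ::
  "'v::finite set set \<Rightarrow> ('v \<Rightarrow> 'v \<Rightarrow> real) \<Rightarrow> ('v set \<Rightarrow> int) \<Rightarrow> real^'v^'v" where
  "signed_laplacian E w \<sigma> = mat 1 - matrix_inv (degree_matrix w) ** signed_adjacency E w \<sigma>"

definition charpoly :: "real^'n^'n \<Rightarrow> real poly" where
  "charpoly M = det (\<chi> i j. if i = j then [:- (M $ i $ j), 1:] else [:- (M $ i $ j):])"

(* The k-th smallest real eigenvalue (k = 1, 2, ...), counted with algebraic multiplicity.
   Only meaningful for k up to the number of real roots of the characteristic polynomial;
   a signed Laplacian is similar to a symmetric matrix, hence has all N roots real. *)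
definition eigval :: "real^'n^'n \<Rightarrow> nat \<Rightarrow> real" where
  "eigval M k = sorted_list_of_multiset (proots (charpoly M)) ! (k - 1)"

definition vol :: "('v \<Rightarrow> real) \<Rightarrow> 'v set \<Rightarrow> real" where
  "vol \<mu> S = (\<Sum>u\<in>S. \<mu> u)"

definition edge_weight :: "('v \<Rightarrow> 'v \<Rightarrow> real) \<Rightarrow> 'v set \<Rightarrow> 'v set \<Rightarrow> real" where
  "edge_weight w V1 V2 = (\<Sum>u\<in>V1. \<Sum>v\<in>V2. w u v)"

(* The weight of the edges of sign s, with s = 1 for |E^+(V1,V2)| and s = -1 for |E^-(V1,V2)|.
   Sums run over ordered pairs, so for V1 = V2 every edge is counted twice. *)
definition signed_edge_weight ::
  "'v set set \<Rightarrow> ('v \<Rightarrow> 'v \<Rightarrow> real) \<Rightarrow> ('v set \<Rightarrow> int) \<Rightarrow> int \<Rightarrow> 'v set \<Rightarrow> 'v set \<Rightarrow> real" where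
  "signed_edge_weight E w \<sigma> s V1 V2 =
     (\<Sum>u\<in>V1. \<Sum>v\<in>{v \<in> V2. {u, v} \<in> E \<and> \<sigma> {u, v} = s}. w u v)"

definition signed_bipartiteness_ratio ::
  "'v set set \<Rightarrow> ('v \<Rightarrow> 'v \<Rightarrow> real) \<Rightarrow> ('v set \<Rightarrow> int) \<Rightarrow> ('v \<Rightarrow> real) \<Rightarrow> 'v set \<Rightarrow> 'v set \<Rightarrow> real" where
  "signed_bipartiteness_ratio E w \<sigma> \<mu> V1 V2 =
     (2 * signed_edge_weight E w \<sigma> 1 V1 V2
        + signed_edge_weight E w \<sigma> (- 1) V1 V1
        + signed_edge_weight E w \<sigma> (- 1) V2 V2
        + edge_weight w (V1 \<union> V2) (- (V1 \<union> V2)))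
     / vol \<mu> (V1 \<union> V2)"

definition signed_cheeger ::
  "'v::finite set set \<Rightarrow> ('v \<Rightarrow> 'v \<Rightarrow> real) \<Rightarrow> ('v set \<Rightarrow> int) \<Rightarrow> ('v \<Rightarrow> real) \<Rightarrow> real" where
  "signed_cheeger E w \<sigma> \<mu> =
     Min {signed_bipartiteness_ratio E w \<sigma> \<mu> V1 V2 | V1 V2. V1 \<inter> V2 = {} \<and> V1 \<union> V2 \<noteq> {}}"

end

theory Submission
  imports Defs
begin

text \<open>The argument adapts the improved Cheeger inequality of Kwok, Lau, Lee, Oveis Gharan and Trevisan.
  Let \<open>f\<close> be a normalized eigenfunction for \<open>\<lambda>\<^sub>1\<close>. Choose thresholds
  \<open>0 = t\<^sub>0 \<le> t\<^sub>1 \<le> \<dots> \<le> t\<^sub>2\<^sub>k\<close> greedily such that the function cut out of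
  \<open>f\<close> by the tent over \<open>[t\<^sub>i, t\<^sub>i\<^sub>+\<^sub>1]\<close> (applied to \<open>\<bar>f\<bar>\<close>, keeping the sign of \<open>f\<close>) has
  squared norm \<open>C\<close>. If \<open>2k\<close> such pieces existed, the \<open>k\<close> of least energy would be disjointly
  supported with energy at most \<open>\<lambda>\<^sub>1 / k\<close> each, forcing \<open>\<lambda>\<^sub>k \<le> 2 \<lambda>\<^sub>1 / (k C)\<close>. So for larger
  \<open>C\<close> the thresholds exhaust the range of \<open>\<bar>f\<bar>\<close>, and \<open>\<bar>f\<bar>\<close> is within squared distance
  \<open>2 k C\<close> of a step function. Applying the linear Cheeger bound to \<open>H \<circ> f\<close>, where \<open>H\<close> is the
  odd primitive of the distance to the set of thresholds, gives
  \<open>h \<le> 4 k \<lambda>\<^sub>1 + 8 k s\<close> for every \<open>s > \<surd>2 \<lambda>\<^sub>1 / \<surd>\<lambda>\<^sub>k\<close>; one of the two summands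
  is at least half of the total.\<close>

no_notation fps_nth (infixl "$" 75)

section \<open>Spectra of symmetric matrices\<close>

text \<open>A maximizer of \<open>x \<bullet> T x\<close> over the unit vectors of \<open>W\<close>
  is an eigenvector: compactness provides it, and the first variation there vanishes.\<close>

lemma selfadjoint_unit_eigenvector:
  fixes T :: "'a::euclidean_space \<Rightarrow> 'a"
  assumes T: "linear T" and sym: "\<And>x y. T x \<bullet> y = x \<bullet> T y"
    and W: "subspace W" "W \<noteq> {0}" and inv: "\<And>x. x \<in> W \<Longrightarrow> T x \<in> W"
  obtains x c where "x \<in> W" "norm x = 1" "T x = c *\<^sub>R x"
proof -
  have cont: "continuous_on S T" for S
    using T by (simp add: linear_continuous_on linear_linear)
  obtain z where z: "z \<in> W" "z \<noteq> 0"
    using W subspace_0 by blast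
  have ne: "sphere 0 1 \<inter> W \<noteq> {}"
  proof -
    have "(1 / norm z) *\<^sub>R z \<in> sphere 0 1 \<inter> W"
      using z W(1) by (simp add: subspace_scale)
    then show ?thesis by blast
  qed
  have "compact (sphere (0::'a) 1 \<inter> W)"
    by (intro compact_Int_closed compact_sphere closed_subspace W(1))
  then obtain x where x: "x \<in> sphere 0 1 \<inter> W"
    and mx: "\<And>y. y \<in> sphere 0 1 \<inter> W \<Longrightarrow> y \<bullet> T y \<le> x \<bullet> T x"
    using continuous_attains_sup[OF _ ne continuous_on_inner[OF continuous_on_id cont]]
    by blast
  define c where "c = x \<bullet> T x"
  have xx: "x \<bullet> x = 1" and xW: "x \<in> W" "norm x = 1"
    using x by (auto simp: dot_square_norm)
  define q where "q y = c * (y \<bullet> y) - y \<bullet> T y" for y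
  have q_nonneg: "q y \<ge> 0" if "y \<in> W" for y
  proof (cases "y = 0")
    case False
    have "(1 / norm y) *\<^sub>R y \<in> sphere 0 1 \<inter> W"
      using False that W(1) by (simp add: subspace_scale)
    from mx[OF this] have "(y \<bullet> T y) / (norm y)\<^sup>2 \<le> c"
      using False by (simp add: linear_scale[OF T] c_def power2_eq_square)
    then show ?thesis
      using False by (simp add: q_def dot_square_norm divide_le_eq)
  qed (simp add: q_def)
  \<comment> \<open>The residual of the eigenvalue equation. Since \<open>q\<close> is nonnegative
    on \<open>W\<close> and vanishes at \<open>x\<close>, its linear term in the direction
    \<open>y\<close> must vanish, which forces \<open>y = 0\<close>.\<close>
  define y where "y = c *\<^sub>R x - T x"
  have yW: "y \<in> W"
    unfolding y_def using xW inv W(1) by (simp add: subspace_diff subspace_scale)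
  have exp: "q (x + t *\<^sub>R y) = 2 * t * (y \<bullet> y) + t\<^sup>2 * q y" for t
  proof -
    have "q (x + t *\<^sub>R y) = c * (1 + 2 * t * (x \<bullet> y) + t\<^sup>2 * (y \<bullet> y))
        - (c + 2 * t * (y \<bullet> T x) + t\<^sup>2 * (y \<bullet> T y))"
      using sym[of x y] by (simp add: q_def linear_add[OF T] linear_scale[OF T] c_def[symmetric] xx
          inner_simps power2_eq_square algebra_simps inner_commute)
    also have "\<dots> = 2 * t * (y \<bullet> (c *\<^sub>R x - T x)) + t\<^sup>2 * q y"
      by (simp add: q_def inner_simps algebra_simps inner_commute)
    finally show ?thesis by (simp add: y_def)
  qed
  have "y \<bullet> y = 0"
  proof (rule ccontr)
    assume "y \<bullet> y \<noteq> 0"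
    then have pos: "y \<bullet> y > 0" by simp
    \<comment> \<open>A step this short keeps the quadratic term at most half of the linear one; the
      \<open>+ 1\<close> avoids division by zero when \<open>q y = 0\<close>.\<close>
    define s where "s = (y \<bullet> y) / (q y + 1)"
    have qy: "q y \<ge> 0" using q_nonneg yW by blast
    have s: "s > 0" "s * q y \<le> y \<bullet> y"
      using pos qy by (auto simp: s_def divide_simps mult_le_cancel_left not_less)
    have "0 \<le> q (x + (- s) *\<^sub>R y)"
      using q_nonneg xW yW W(1) by (meson subspace_add subspace_scale)
    also have "\<dots> = s * (s * q y - 2 * (y \<bullet> y))"
      unfolding exp by (simp add: power2_eq_square algebra_simps)
    finally have "0 \<le> s * q y - 2 * (y \<bullet> y)"
      using s(1) by (simp add: zero_le_mult_iff)
    then show False using s(2) pos by linarith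
  qed
  then have "T x = c *\<^sub>R x" by (simp add: y_def)
  then show ?thesis using that xW by blast
qed

text \<open>Induction on \<open>n\<close>: by self-adjointness the orthogonal complement of the
  eigenvectors found so far is invariant, and it is nonzero while their number is below the
  dimension.\<close>

lemma selfadjoint_orthonormal_eigenvectors:
  fixes T :: "'a::euclidean_space \<Rightarrow> 'a"
  assumes T: "linear T" and sym: "\<And>x y. T x \<bullet> y = x \<bullet> T y"
    and "n \<le> DIM('a)"
  shows "\<exists>B. finite B \<and> card B = n \<and> pairwise orthogonal B \<and>
    (\<forall>b\<in>B. norm b = 1 \<and> (\<exists>c. T b = c *\<^sub>R b))"
  using assms(3)
proof (induction n)
  case 0
  then show ?case by (intro exI[of _ "{}"]) simp
next
  case (Suc n)
  then obtain B where B: "finite B" "card B = n" "pairwise orthogonal B"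
    and eig: "\<And>b. b \<in> B \<Longrightarrow> norm b = 1 \<and> (\<exists>c. T b = c *\<^sub>R b)"
    by auto
  define W where "W = {x. \<forall>b\<in>B. b \<bullet> x = 0}"
  have sub: "subspace W"
    by (auto simp: W_def subspace_def inner_simps)
  have inv: "T x \<in> W" if "x \<in> W" for x
  proof -
    have "b \<bullet> T x = 0" if b: "b \<in> B" for b
    proof -
      obtain c where "T b = c *\<^sub>R b" using eig b by blast
      then have "b \<bullet> T x = c * (b \<bullet> x)" by (metis inner_scaleR_left sym)
      then show ?thesis using \<open>x \<in> W\<close> b by (simp add: W_def)
    qed
    then show ?thesis by (simp add: W_def)
  qed
  have "dim B \<le> card B" using B(1) by (rule dim_le_card')
  then have "dim B < DIM('a)" using B(2) Suc.prems by linarith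
  then obtain z where z: "z \<noteq> 0" "\<And>y. y \<in> span B \<Longrightarrow> orthogonal z y"
    using orthogonal_to_subspace_exists[of B] by blast
  then have "z \<in> W"
    by (auto simp: W_def orthogonal_def inner_commute span_base)
  then have "W \<noteq> {0}" using z(1) by blast
  from selfadjoint_unit_eigenvector[OF T sym sub this inv]
  obtain x c where x: "x \<in> W" "norm x = 1" "T x = c *\<^sub>R x" by metis
  have "x \<notin> B"
  proof
    assume "x \<in> B"
    then have "x \<bullet> x = 0" using x(1) by (simp add: W_def)
    then show False using x(2) by simp
  qed
  then show ?case
    using B eig x
    by (intro exI[of _ "insert x B"])
      (auto simp: pairwise_insert W_def orthogonal_def[abs_def] inner_commute)
qed

lemma symmetric_matrix_eigenbasis:
  fixes S :: "real^'n^'n"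
  assumes sym: "transpose S = S"
  obtains e l where "\<And>i j. e i \<bullet> e j = (if i = j then 1 else 0)"
    and "\<And>i::'n. S *v e i = l i *\<^sub>R e i"
proof -
  have "(S *v x) \<bullet> y = x \<bullet> (S *v y)" for x y
    by (metis dot_lmul_matrix sym vector_transpose_matrix)
  from selfadjoint_orthonormal_eigenvectors[OF matrix_vector_mul_linear[of S] this order_refl]
  obtain B where B: "finite B" "card B = CARD('n)" "pairwise orthogonal B"
    and eig: "\<And>b. b \<in> B \<Longrightarrow> norm b = 1 \<and> (\<exists>c. S *v b = c *\<^sub>R b)"
    by auto
  \<comment> \<open>\<open>B\<close> has \<open>CARD('n)\<close> elements, so the index type itself
    can enumerate the eigenvectors; they can then serve as columns of a square matrix.\<close>
  have "\<exists>e. bij_betw e (UNIV :: 'n set) B"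
    by (rule finite_same_card_bij) (simp_all add: B)
  then obtain e :: "'n \<Rightarrow> real^'n" where e: "bij_betw e UNIV B"
    by blast
  have eB: "e i \<in> B" for i using e bij_betwE by blast
  have "\<forall>i. \<exists>c. S *v e i = c *\<^sub>R e i" using eig eB by blast
  then obtain l where l: "\<And>i. S *v e i = l i *\<^sub>R e i" by metis
  have "e i \<bullet> e j = (if i = j then 1 else 0)" for i j
  proof (cases "i = j")
    case True
    then show ?thesis using eig[OF eB[of j]] by (simp add: dot_square_norm)
  next
    case False
    then have "e i \<noteq> e j" using e by (metis UNIV_I bij_betw_def inj_onD)
    then show ?thesis using B(3) eB False by (auto simp: pairwise_def orthogonal_def)
  qed
  then show ?thesis using that l by blast
qed

section \<open>Characteristic polynomials and the ordered list of eigenvalues\<close>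

lemma charpoly_diagonalizable:
  fixes M :: "real^'n^'n" and l :: "'n \<Rightarrow> real"
  assumes inv: "invertible B" and eq: "M ** B = B ** (\<chi> i j. if i = j then l i else 0)"
  shows "charpoly M = (\<Prod>i\<in>UNIV. [:- l i, 1:])"
proof -
  \<comment> \<open>\<open>P\<close> embeds real matrices as matrices of constant polynomials, and
    \<open>X\<close> is the scalar matrix of the indeterminate. Thus \<open>charpoly A\<close> is
    \<open>det (X - P A)\<close>, and the similarity can be carried out over the polynomial
    ring.\<close>
  define P :: "real^'n^'n \<Rightarrow> real poly^'n^'n" where "P A = (\<chi> i j. [:A $ i $ j:])" for A
  define X :: "real poly^'n^'n" where "X = mat [:0, 1:]"
  have P_mult: "P (A ** A') = P A ** P A'" for A A'
  proof -
    have "(\<Sum>k\<in>S. [:f k:]) = [:sum f S:]" for f :: "'n \<Rightarrow> real" and S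
      by (induction S rule: infinite_finite_induct) auto
    then show ?thesis
      by (simp add: P_def matrix_matrix_mult_def vec_eq_iff mult.commute)
  qed
  have XP: "X ** P B = P B ** X"
    by (simp add: X_def mat_def matrix_matrix_mult_def vec_eq_iff if_distrib[of "\<lambda>x. x * _"]
        if_distrib[of "\<lambda>x. _ * x"] cong: if_cong)
  have char: "charpoly A = det (X - P A)" for A
    unfolding charpoly_def X_def P_def
    by (intro arg_cong[of _ _ det]) (auto simp: vec_eq_iff mat_def)
  let ?D = "\<chi> i j. if i = j then l i else 0"
  have "(X - P M) ** P B = P B ** (X - P ?D)"
  proof -
    have "(X - P M) ** P B = X ** P B - P M ** P B"
      and "P B ** (X - P ?D) = P B ** X - P B ** P ?D"
      by (simp_all add: matrix_matrix_mult_def vec_eq_iff algebra_simps sum_subtractf)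
    then show ?thesis using XP P_mult[of M B] P_mult[of B ?D] eq by simp
  qed
  then have "det ((X - P M) ** P B) = det (P B ** (X - P ?D))"
    by (rule arg_cong)
  then have "det (X - P M) * det (P B) = det (P B) * det (X - P ?D)"
    by (simp only: det_mul)
  \<comment> \<open>Polynomials form an integral domain, so a nonzero \<open>det (P B)\<close> can
    be cancelled; an inverse of \<open>B\<close> shows that it is a unit.\<close>
  moreover have "det (P B) \<noteq> 0"
  proof -
    obtain B' where "B ** B' = mat 1" using inv by (auto simp: invertible_def)
    then have "P B ** P B' = P (mat 1)" by (simp flip: P_mult)
    also have "P (mat 1) = mat 1" by (auto simp: P_def mat_def vec_eq_iff one_pCons)
    finally have "det (P B ** P B') = det (mat 1 :: real poly^'n^'n)" by (rule arg_cong)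
    then have "det (P B) * det (P B') = 1" by (simp only: det_mul det_I)
    then show ?thesis by auto
  qed
  ultimately have "charpoly M = det (X - P ?D)" by (simp add: char mult.commute)
  also have "\<dots> = (\<Prod>i\<in>UNIV. (X - P ?D) $ i $ i)"
    by (rule det_diagonal) (simp add: X_def P_def mat_def)
  also have "\<dots> = (\<Prod>i\<in>UNIV. [:- l i, 1:])"
    by (simp add: X_def P_def mat_def)
  finally show ?thesis .
qed

lemma eigval_diagonalizable:
  fixes M :: "real^'n^'n" and l :: "'n \<Rightarrow> real"
  assumes "invertible B" "M ** B = B ** (\<chi> i j. if i = j then l i else 0)"
  shows "eigval M k = sorted_list_of_multiset (image_mset l (mset_set UNIV)) ! (k - 1)"
proof -
  have "proots (charpoly M) = image_mset l (mset_set UNIV)"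
    unfolding charpoly_diagonalizable[OF assms]
    by (subst proots_prod) (auto simp: sum_unfold_sum_mset)
  then show ?thesis by (simp add: eigval_def)
qed

section \<open>Counting eigenvalues below a level\<close>

lemma length_filter_le_sorted:
  fixes xs :: "'a::linorder list"
  assumes "sorted xs" "i < length xs" "t < xs ! i"
  shows "length (filter (\<lambda>x. x \<le> t) xs) \<le> i"
proof -
  have "filter (\<lambda>x. x \<le> t) (drop i xs) = []"
  proof -
    have "t < x" if "x \<in> set (drop i xs)" for x
    proof -
      obtain j where j: "j < length (drop i xs)" "x = drop i xs ! j"
        using \<open>x \<in> set (drop i xs)\<close> unfolding in_set_conv_nth by blast
      then have "xs ! i \<le> xs ! (i + j)"
        using assms(1) by (intro sorted_nth_mono) auto
      then show ?thesis
        using assms(2,3) j by simp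
    qed
    then show ?thesis by (fastforce simp: filter_empty_conv)
  qed
  then have "length (filter (\<lambda>x. x \<le> t) xs) = length (filter (\<lambda>x. x \<le> t) (take i xs))"
    using filter_append[of "\<lambda>x. x \<le> t" "take i xs" "drop i xs"] by simp
  also have "\<dots> \<le> length (take i xs)"
    by (rule length_filter_le)
  finally show ?thesis by simp
qed

text \<open>If entry \<open>k - 1\<close>, counted from 0, exceeded \<open>t\<close>, at most
  \<open>k - 1\<close> entries of the sorted list could be at most \<open>t\<close>.\<close>

lemma card_ge_imp_sorted_nth_le:
  fixes l :: "'n::finite \<Rightarrow> real"
  assumes k: "1 \<le> k" "k \<le> CARD('n)" "k \<le> card {i. l i \<le> t}"
  shows "sorted_list_of_multiset (image_mset l (mset_set UNIV)) ! (k - 1) \<le> t"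
proof (rule ccontr)
  define xs where "xs = sorted_list_of_multiset (image_mset l (mset_set UNIV))"
  have mset: "mset xs = image_mset l (mset_set UNIV)"
    by (simp add: xs_def)
  assume "\<not> ?thesis"
  then have "t < xs ! (k - 1)" by (simp add: xs_def)
  moreover have "length xs = CARD('n)"
    by (metis mset size_image_mset size_mset size_mset_set)
  ultimately have "length (filter (\<lambda>x. x \<le> t) xs) \<le> k - 1"
    using k by (intro length_filter_le_sorted) (auto simp: xs_def)
  also have "length (filter (\<lambda>x. x \<le> t) xs) = size (filter_mset (\<lambda>x. x \<le> t) (mset xs))"
    by (metis mset_filter size_mset)
  also have "\<dots> = card {i. l i \<le> t}"
    by (simp add: mset filter_mset_image_mset)
  finally show False using k by linarith
qed

text \<open>One half of the Courant-Fischer principle. If too few eigenvalues were at most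
  \<open>t\<close>, the span \<open>U\<close> of the eigenvectors with larger eigenvalues would meet
  \<open>W\<close> nontrivially by dimension, and a nonzero common vector has Rayleigh quotient
  above \<open>t\<close>.\<close>

lemma card_eigenvalues_ge_dim:
  fixes S :: "real^'n^'n"
  assumes orth: "\<And>i j. e i \<bullet> e j = (if i = j then 1 else 0)"
    and eig: "\<And>i::'n. S *v e i = l i *\<^sub>R e i"
    and W: "subspace W" and le: "\<And>y. y \<in> W \<Longrightarrow> y \<bullet> (S *v y) \<le> t * (y \<bullet> y)"
  shows "dim W \<le> card {i. l i \<le> t}"
proof (rule ccontr)
  define I where "I = {i. \<not> l i \<le> t}"
  define U where "U = span (e ` I)"
  assume "\<not> ?thesis"
  moreover have "card I + card {i. l i \<le> t} = CARD('n)"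
  proof -
    have "UNIV = I \<union> {i. l i \<le> t}" by (auto simp: I_def)
    then show ?thesis
      by (metis (no_types, lifting) I_def card_Un_disjoint disjoint_iff finite_code mem_Collect_eq)
  qed
  ultimately have dimW: "CARD('n) < card I + dim W" by linarith
  have inj: "inj_on e A" for A
  proof (rule inj_onI)
    fix i j assume "e i = e j"
    then show "i = j" using orth[of i j] orth[of j j] by (auto split: if_splits)
  qed
  have "independent (e ` I)"
  proof (rule pairwise_orthogonal_independent)
    show "pairwise orthogonal (e ` I)"
      using orth by (auto simp: pairwise_def orthogonal_def)
    show "0 \<notin> e ` I"
      using orth by (metis imageE inner_zero_left zero_neq_one)
  qed
  then have "dim U = card I"
    by (simp add: U_def dim_eq_card_independent card_image[OF inj])
  moreover have "dim {x + y |x y. x \<in> U \<and> y \<in> W} + dim (U \<inter> W) = dim U + dim W"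
    using W by (intro dim_sums_Int) (auto simp: U_def)
  moreover have "dim {x + y |x y. x \<in> U \<and> y \<in> W} \<le> CARD('n)"
    using dim_subset_UNIV[of "{x + y |x y. x \<in> U \<and> y \<in> W}"] by simp
  ultimately have "dim (U \<inter> W) \<noteq> 0" using dimW by linarith
  then obtain y where y: "y \<in> U" "y \<in> W" "y \<noteq> 0" by auto
  then obtain a where "y = (\<Sum>v\<in>e ` I. a v *\<^sub>R v)"
    by (auto simp: U_def span_finite)
  then have y_eq: "y = (\<Sum>i\<in>I. a (e i) *\<^sub>R e i)"
    by (simp add: sum.reindex[OF inj])
  define c where "c i = a (e i)" for i
  have Sy: "S *v y = (\<Sum>i\<in>I. (c i * l i) *\<^sub>R e i)"
    unfolding y_eq by (simp add: c_def eig linear_sum[OF matrix_vector_mul_linear] linear_scale[OF matrix_vector_mul_linear])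
  have dot: "(\<Sum>i\<in>I. p i *\<^sub>R e i) \<bullet> (\<Sum>i\<in>I. r i *\<^sub>R e i) = (\<Sum>i\<in>I. p i * r i)" for p r
    by (simp add: inner_sum_left inner_sum_right orth if_distrib[of "\<lambda>x. _ * x"] mult.commute
        cong: if_cong)
  have yy: "y \<bullet> y = (\<Sum>i\<in>I. c i * c i)"
    unfolding y_eq dot c_def ..
  have yS: "y \<bullet> (S *v y) = (\<Sum>i\<in>I. c i * (c i * l i))"
    unfolding Sy unfolding y_eq dot c_def ..
  have "\<exists>i\<in>I. c i \<noteq> 0"
    using y(3) yy by (metis (no_types, lifting) inner_eq_zero_iff mult_eq_0_iff sum.neutral)
  then have "(\<Sum>i\<in>I. t * (c i * c i)) < (\<Sum>i\<in>I. c i * (c i * l i))"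
  proof (intro sum_strict_mono_ex1)
    have eq: "c i * (c i * l i) - t * (c i * c i) = (l i - t) * (c i)\<^sup>2" for i
      by (simp add: algebra_simps power2_eq_square)
    have "(l i - t) * (c i)\<^sup>2 \<ge> 0" if "i \<in> I" for i
      using that by (auto simp: I_def)
    then show "\<forall>i\<in>I. t * (c i * c i) \<le> c i * (c i * l i)"
      using eq by (metis diff_ge_0_iff_ge)
    assume "\<exists>i\<in>I. c i \<noteq> 0"
    then obtain i where i: "i \<in> I" "c i \<noteq> 0" by blast
    then have "(l i - t) * (c i)\<^sup>2 > 0"
      by (auto simp: I_def)
    then show "\<exists>i\<in>I. t * (c i * c i) < c i * (c i * l i)"
      using eq i(1) by (metis diff_gt_0_iff_gt)
  qed simp
  then show False
    using le[OF y(2)] yy yS by (simp add: sum_distrib_left)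
qed

section \<open>Tent functions\<close>

text \<open>For \<open>0 \<le> a \<le> b\<close>, the difference \<open>clip b x - clip a x\<close>
  is the part of \<open>x\<close> lying in the band between \<open>a\<close> and \<open>b\<close>,
  with the sign of \<open>x\<close>. Such parts telescope over consecutive bands.\<close>

definition clip :: "real \<Rightarrow> real \<Rightarrow> real" where
  "clip b x = max (- b) (min b x)"

text \<open>The factor \<open>sgn x\<close> makes the function odd, so that an edge sign can be
  moved inside it.\<close>

definition tent :: "real \<Rightarrow> real \<Rightarrow> real \<Rightarrow> real" where
  "tent a b x = sgn x * max 0 (min (\<bar>x\<bar> - a) (b - \<bar>x\<bar>))"

lemma tent_0 [simp]: "tent a b 0 = 0"
  by (simp add: tent_def)

lemma tent_uminus: "tent a b (- x) = - tent a b x"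
  by (simp add: tent_def sgn_minus)

text \<open>The tent is a 1-Lipschitz function of the band part \<open>p\<close>: on each side of
  zero it is \<open>p\<close> folded at half the band width, which \<open>tent_eq\<close> makes
  explicit.\<close>

lemma tent_diff_le_clip:
  assumes "0 \<le> a" "a \<le> b"
  shows "\<bar>tent a b x - tent a b y\<bar> \<le> \<bar>(clip b x - clip a x) - (clip b y - clip a y)\<bar>"
proof -
  define p where "p z = clip b z - clip a z" for z
  have tent_eq: "tent a b z = (if p z > (b - a) / 2 then b - a - p z
      else if p z < - (b - a) / 2 then - (b - a) - p z else p z)" for z
    using assms by (auto simp: p_def tent_def clip_def sgn_if max_def min_def abs_if split: if_splits)
  have "\<bar>tent a b x - tent a b y\<bar> \<le> \<bar>p x - p y\<bar>"
    using assms(2) unfolding tent_eq[of x] tent_eq[of y] by (auto simp: abs_if)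
  then show ?thesis by (simp add: p_def)
qed

lemma clip_diff_mono:
  assumes "0 \<le> a" "a \<le> b" "x \<le> y"
  shows "clip b x - clip a x \<le> clip b y - clip a y"
  using assms by (auto simp: clip_def max_def min_def)

text \<open>Each tent varies no more than the part of its argument in its own band. These parts are
  nondecreasing, so their increments need no absolute values and telescope.\<close>

lemma sum_tent_diff_le:
  fixes t :: "nat \<Rightarrow> real"
  assumes t: "mono t" "t 0 = 0"
  shows "(\<Sum>i<n. \<bar>tent (t i) (t (Suc i)) x - tent (t i) (t (Suc i)) y\<bar>) \<le> \<bar>x - y\<bar>"
proof -
  have t_nn: "0 \<le> t i" "t i \<le> t (Suc i)" for i
    using t monoD[OF t(1), of 0 i] monoD[OF t(1), of i "Suc i"] by auto
  have le: "(\<Sum>i<n. \<bar>tent (t i) (t (Suc i)) x - tent (t i) (t (Suc i)) y\<bar>) \<le> y - x"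
    if "x \<le> y" for x y
  proof -
    have "(\<Sum>i<n. \<bar>tent (t i) (t (Suc i)) x - tent (t i) (t (Suc i)) y\<bar>)
        \<le> (\<Sum>i<n. (clip (t (Suc i)) y - clip (t (Suc i)) x) - (clip (t i) y - clip (t i) x))"
    proof (rule sum_mono)
      fix i
      show "\<bar>tent (t i) (t (Suc i)) x - tent (t i) (t (Suc i)) y\<bar>
        \<le> (clip (t (Suc i)) y - clip (t (Suc i)) x) - (clip (t i) y - clip (t i) x)"
        using tent_diff_le_clip[OF t_nn(1) t_nn(2), of i x y]
          clip_diff_mono[OF t_nn(1) t_nn(2) that, of i] by linarith
    qed
    also have "\<dots> = (clip (t n) y - clip (t n) x) - (clip (t 0) y - clip (t 0) x)"
      by (rule sum_lessThan_telescope)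
    also have "\<dots> \<le> y - x"
      using that t_nn(1)[of n] t(2) by (auto simp: clip_def)
    finally show ?thesis .
  qed
  show ?thesis
    using le[of x y] le[of y x] by (cases "x \<le> y") (auto simp: abs_minus_commute)
qed

text \<open>A sum of squares is at most the square of the sum of absolute values. Applied along each
  edge, this shows that cutting a function into tents does not increase the total energy.\<close>

lemma sum_tent_diff_square_le:
  fixes t :: "nat \<Rightarrow> real"
  assumes "mono t" "t 0 = 0"
  shows "(\<Sum>i<n. (tent (t i) (t (Suc i)) x - tent (t i) (t (Suc i)) y)\<^sup>2) \<le> (x - y)\<^sup>2"
proof -
  have sq: "(\<Sum>i<m. (g i)\<^sup>2) \<le> (\<Sum>i<m. \<bar>g i\<bar>)\<^sup>2" for g :: "nat \<Rightarrow> real" and m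
  proof (induction m)
    case (Suc m)
    have "0 \<le> (\<Sum>i<m. \<bar>g i\<bar>) * \<bar>g m\<bar>"
      by (intro mult_nonneg_nonneg sum_nonneg) auto
    then have "0 \<le> 2 * (\<Sum>i<m. \<bar>g i\<bar>) * \<bar>g m\<bar>" by simp
    with Suc show ?case by (simp only: sum.lessThan_Suc power2_sum power2_abs)
  qed simp
  have "(\<Sum>i<n. (tent (t i) (t (Suc i)) x - tent (t i) (t (Suc i)) y)\<^sup>2)
      \<le> (\<Sum>i<n. \<bar>tent (t i) (t (Suc i)) x - tent (t i) (t (Suc i)) y\<bar>)\<^sup>2"
    by (rule sq)
  also have "\<dots> \<le> \<bar>x - y\<bar>\<^sup>2"
    using sum_tent_diff_le[OF assms] by (intro power_mono sum_nonneg) auto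
  finally show ?thesis by simp
qed

lemma tent_nonzero_iff: "tent a b x \<noteq> 0 \<longleftrightarrow> x \<noteq> 0 \<and> a < \<bar>x\<bar> \<and> \<bar>x\<bar> < b"
  by (auto simp: tent_def sgn_if max_def min_def)

lemma tent_disjoint:
  fixes t :: "nat \<Rightarrow> real"
  assumes t: "mono t" and "i \<noteq> j"
  shows "tent (t i) (t (Suc i)) x * tent (t j) (t (Suc j)) x = 0"
proof (rule ccontr)
  assume "\<not> ?thesis"
  then have "tent (t i) (t (Suc i)) x \<noteq> 0" "tent (t j) (t (Suc j)) x \<noteq> 0" by auto
  then have "t i < t (Suc j)" "t j < t (Suc i)"
    unfolding tent_nonzero_iff by linarith+
  moreover have "t (Suc i) \<le> t j \<or> t (Suc j) \<le> t i"
    using \<open>i \<noteq> j\<close> t by (metis Suc_leI linorder_neqE_nat monoD)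
  ultimately show False by linarith
qed

text \<open>For monotone \<open>t\<close> with \<open>t 0 = 0\<close> and |x| at most
  \<open>t n\<close>, this is the distance from |x| to the nearest of \<open>t 0\<close>, ...,
  \<open>t n\<close>: the tents have disjoint supports, so at most one summand is nonzero. Beyond
  \<open>t n\<close> it is zero.\<close>

definition step_dist :: "(nat \<Rightarrow> real) \<Rightarrow> nat \<Rightarrow> real \<Rightarrow> real" where
  "step_dist t n x = (\<Sum>i<n. \<bar>tent (t i) (t (Suc i)) x\<bar>)"

lemma step_dist_nonneg: "step_dist t n x \<ge> 0"
  by (simp add: step_dist_def sum_nonneg)

lemma step_dist_uminus: "step_dist t n (- x) = step_dist t n x"
  by (simp add: step_dist_def tent_uminus)

lemma step_dist_lipschitz:
  assumes "mono t" "t 0 = 0"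
  shows "\<bar>step_dist t n x - step_dist t n y\<bar> \<le> \<bar>x - y\<bar>"
proof -
  have "\<bar>step_dist t n x - step_dist t n y\<bar>
      \<le> (\<Sum>i<n. \<bar>\<bar>tent (t i) (t (Suc i)) x\<bar> - \<bar>tent (t i) (t (Suc i)) y\<bar>\<bar>)"
    unfolding step_dist_def sum_subtractf[symmetric] by (rule sum_abs)
  also have "\<dots> \<le> (\<Sum>i<n. \<bar>tent (t i) (t (Suc i)) x - tent (t i) (t (Suc i)) y\<bar>)"
    by (rule sum_mono) linarith
  also have "\<dots> \<le> \<bar>x - y\<bar>"
    by (rule sum_tent_diff_le[OF assms])
  finally show ?thesis .
qed

text \<open>Disjoint supports kill the cross terms. Weighted sums of this square are therefore sums
  of tent masses.\<close>

lemma step_dist_square: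
  assumes "mono t"
  shows "(step_dist t n x)\<^sup>2 = (\<Sum>i<n. (tent (t i) (t (Suc i)) x)\<^sup>2)"
proof (induction n)
  case (Suc n)
  have "step_dist t n x * \<bar>tent (t n) (t (Suc n)) x\<bar> = 0"
    unfolding step_dist_def sum_distrib_right
    using tent_disjoint[OF assms] by (intro sum.neutral) (metis abs_0 abs_mult lessThan_iff less_irrefl)
  moreover have "step_dist t (Suc n) x = step_dist t n x + \<bar>tent (t n) (t (Suc n)) x\<bar>"
    by (simp add: step_dist_def)
  ultimately show ?case using Suc by (simp add: power2_sum)
qed (simp add: step_dist_def)

lemma step_dist_ge_tent:
  assumes "i < n"
  shows "step_dist t n x \<ge> \<bar>tent (t i) (t (Suc i)) x\<bar>"
  unfolding step_dist_def using assms by (intro member_le_sum) auto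

section \<open>A primitive of the distance to the thresholds\<close>

lemma odd_primitive:
  fixes g :: "real \<Rightarrow> real"
  assumes cont: "continuous_on UNIV g" and even: "\<And>x. g (- x) = g x"
  obtains H where "\<And>x. H (- x) = - H x"
    and "\<And>x. \<bar>x\<bar> < K \<Longrightarrow> (H has_real_derivative g x) (at x)"
proof -
  obtain G where G: "\<And>x. x \<in> {-K..K} \<Longrightarrow> (G has_vector_derivative g x) (at x within {-K..K})"
    using antiderivative_continuous[of "-K" K g] cont continuous_on_subset by blast
  have dG: "(G has_real_derivative g x) (at x)" if "\<bar>x\<bar> < K" for x
  proof -
    have "at x within {-K..K} = at x"
      using that by (intro at_within_interior) auto
    then show ?thesis
      using G[of x] that by (simp add: has_real_derivative_iff_has_vector_derivative abs_le_iff abs_less_iff)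
  qed
  \<comment> \<open>\<open>H\<close> is the odd part of the antiderivative \<open>G\<close>; as
    \<open>g\<close> is even, passing to the odd part leaves the derivative unchanged.\<close>
  show thesis
  proof
    show "(G (- x) - G (- (- x))) / 2 = - ((G x - G (- x)) / 2)" for x
      by (simp add: field_simps)
    show "((\<lambda>x. (G x - G (- x)) / 2) has_real_derivative g x) (at x)" if "\<bar>x\<bar> < K" for x
    proof -
      have "((\<lambda>x. G (- x)) has_real_derivative g x * - 1) (at x)"
        using dG[of "- x"] that even[of x]
        by (intro DERIV_chain2[where f = G and g = uminus]) (auto intro!: derivative_eq_intros)
      from DERIV_diff[OF dG[OF that] this]
      have "((\<lambda>x. (G x - G (- x)) / 2) has_real_derivative (g x - g x * - 1) / 2) (at x)"
        by (rule DERIV_cdivide)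
      then show ?thesis by simp
    qed
  qed
qed

text \<open>Mean value theorem, with \<open>step_dist\<close> at the intermediate point bounded from
  both ends by the Lipschitz property; averaging the two bounds gives the symmetric form.\<close>

lemma primitive_diff_le:
  assumes t: "mono t" "t 0 = 0"
    and H: "\<And>x. \<bar>x\<bar> < K \<Longrightarrow> (H has_real_derivative step_dist t n x) (at x)"
    and "\<bar>x\<bar> < K" "\<bar>y\<bar> < K"
  shows "\<bar>H x - H y\<bar> \<le> \<bar>x - y\<bar> * (step_dist t n x + step_dist t n y + \<bar>x - y\<bar>) / 2"
proof -
  have lt: "\<bar>H x - H y\<bar> \<le> \<bar>x - y\<bar> * (step_dist t n x + step_dist t n y + \<bar>x - y\<bar>) / 2"
    if "x < y" "\<bar>x\<bar> < K" "\<bar>y\<bar> < K" for x y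
  proof -
    have "(H has_real_derivative step_dist t n z) (at z)" if "x \<le> z" "z \<le> y" for z
      using H[of z] that \<open>\<bar>x\<bar> < K\<close> \<open>\<bar>y\<bar> < K\<close> by linarith
    then obtain z where z: "x < z" "z < y" "H y - H x = (y - x) * step_dist t n z"
      using MVT2[OF \<open>x < y\<close>, of H "step_dist t n"] by blast
    have "step_dist t n z - step_dist t n x \<le> z - x" "step_dist t n z - step_dist t n y \<le> y - z"
      using step_dist_lipschitz[OF t, of n z x] step_dist_lipschitz[OF t, of n z y] z(1,2)
      by (simp_all add: abs_le_iff)
    then have "step_dist t n z \<le> (step_dist t n x + step_dist t n y + (y - x)) / 2"
      by (simp add: field_simps)
    then have "(y - x) * step_dist t n z \<le> (y - x) * ((step_dist t n x + step_dist t n y + (y - x)) / 2)"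
      using \<open>x < y\<close> by (intro mult_left_mono) auto
    moreover have "0 \<le> (y - x) * step_dist t n z"
      using \<open>x < y\<close> step_dist_nonneg by simp
    then have "\<bar>H x - H y\<bar> = (y - x) * step_dist t n z"
      using z(3) by linarith
    moreover have "\<bar>x - y\<bar> = y - x"
      using \<open>x < y\<close> by simp
    ultimately show ?thesis by simp
  qed
  consider "x < y" | "y < x" | "x = y" by linarith
  then show ?thesis
    using lt[of x y] lt[of y x] assms(4,5)
    by cases (simp_all add: abs_minus_commute add.commute)
qed

text \<open>\<open>H\<close> grows at least by the area under a tent over \<open>[p, q]\<close>. The
  constant 4 is dictated by the full band, where that area is
  \<open>(q - p)\<^sup>2 / 4\<close>.\<close>

lemma primitive_increment_ge:
  fixes H g :: "real \<Rightarrow> real"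
  assumes H: "\<And>z. p \<le> z \<Longrightarrow> z \<le> q \<Longrightarrow> (H has_real_derivative g z) (at z)"
    and g: "\<And>z. p \<le> z \<Longrightarrow> z \<le> q \<Longrightarrow> min (z - p) (q - z) \<le> g z"
    and y: "p \<le> y" "y \<le> q"
  shows "(y - p)\<^sup>2 / 4 \<le> H y - H p"
proof -
  have left: "(z - p)\<^sup>2 / 2 \<le> H z - H p" if "p \<le> z" "z \<le> (p + q) / 2" for z
  proof -
    have "H p - (p - p)\<^sup>2 / 2 \<le> H z - (z - p)\<^sup>2 / 2"
    proof (rule DERIV_nonneg_imp_nondecreasing[OF that(1)])
      fix x assume x: "p \<le> x" "x \<le> z"
      have "((\<lambda>z. H z - (z - p)\<^sup>2 / 2) has_real_derivative g x - (x - p)) (at x)"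
        using x that by (auto intro!: derivative_eq_intros H simp: field_simps)
      moreover have "g x - (x - p) \<ge> 0"
        using g[of x] x that by (auto simp: min_def split: if_splits)
      ultimately show "\<exists>y. ((\<lambda>z. H z - (z - p)\<^sup>2 / 2) has_real_derivative y) (at x) \<and> y \<ge> 0"
        by blast
    qed
    then show ?thesis by simp
  qed
  show ?thesis
  proof (cases "y \<le> (p + q) / 2")
    case True
    have "(y - p)\<^sup>2 / 4 \<le> (y - p)\<^sup>2 / 2" by simp
    then show ?thesis using left[OF y(1) True] by linarith
  next
    case False
    define m where "m = (p + q) / 2"
    have m: "p \<le> m" "m \<le> y" using False y by (auto simp: m_def)
    have "H m + (q - m)\<^sup>2 / 2 \<le> H y + (q - y)\<^sup>2 / 2"
    proof (rule DERIV_nonneg_imp_nondecreasing[OF m(2)])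
      fix x assume x: "m \<le> x" "x \<le> y"
      have "((\<lambda>z. H z + (q - z)\<^sup>2 / 2) has_real_derivative g x - (q - x)) (at x)"
        using x m y by (auto intro!: derivative_eq_intros H simp: field_simps)
      moreover have "g x - (q - x) \<ge> 0"
        using g[of x] x m y by (auto simp: min_def m_def split: if_splits)
      ultimately show "\<exists>y. ((\<lambda>z. H z + (q - z)\<^sup>2 / 2) has_real_derivative y) (at x) \<and> y \<ge> 0"
        by blast
    qed
    moreover have "(m - p)\<^sup>2 / 2 \<le> H m - H p"
      using left[OF m(1)] by (simp add: m_def)
    ultimately have "(m - p)\<^sup>2 / 2 + (q - m)\<^sup>2 / 2 - (q - y)\<^sup>2 / 2 \<le> H y - H p"
      by linarith
    \<comment> \<open>The excess over the claimed bound factors, and past the midpoint both factors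
      are nonnegative.\<close>
    moreover have "(m - p)\<^sup>2 / 2 + (q - m)\<^sup>2 / 2 - (q - y)\<^sup>2 / 2 - (y - p)\<^sup>2 / 4
        = (q - y) * (3 * y - 2 * p - q) / 4"
      by (simp add: m_def power2_eq_square field_simps)
    moreover have "(q - y) * (3 * y - 2 * p - q) \<ge> 0"
      using False y by (intro mult_nonneg_nonneg) auto
    ultimately show ?thesis by linarith
  qed
qed

text \<open>Split \<open>[0, x]\<close> at the thresholds. Each piece contributes at least a quarter
  of its squared length to \<open>H x\<close>, and Cauchy-Schwarz over the \<open>n\<close> pieces
  costs the factor \<open>n\<close>.\<close>

lemma primitive_ge_square:
  fixes t :: "nat \<Rightarrow> real"
  assumes t: "mono t" "t 0 = 0" and K: "t n < K"
    and H: "\<And>x. \<bar>x\<bar> < K \<Longrightarrow> (H has_real_derivative step_dist t n x) (at x)" and H0: "H 0 = 0"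
    and x: "0 \<le> x" "x \<le> t n"
  shows "x\<^sup>2 \<le> 4 * real n * H x"
proof -
  have tm: "t i \<le> t j" if "i \<le> j" for i j
    using t(1) that by (rule monoD)
  \<comment> \<open>Endpoints of the pieces; thresholds beyond \<open>x\<close> give degenerate
    pieces.\<close>
  define c where "c i = min x (t i)" for i
  have piece: "(c (Suc i) - c i)\<^sup>2 / 4 \<le> H (c (Suc i)) - H (c i)" if "i < n" for i
  proof (cases "x \<le> t i")
    case True
    then show ?thesis using tm[of i "Suc i"] by (simp add: c_def min_def)
  next
    case False
    have t0: "0 \<le> t i" using tm[of 0 i] t(2) by simp
    have tn: "t (Suc i) \<le> t n" using that by (intro tm) simp
    have "(c (Suc i) - t i)\<^sup>2 / 4 \<le> H (c (Suc i)) - H (t i)"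
    proof (rule primitive_increment_ge[where g = "step_dist t n" and q = "t (Suc i)"])
      fix z assume z: "t i \<le> z" "z \<le> t (Suc i)"
      show "(H has_real_derivative step_dist t n z) (at z)"
        using z t0 tn K by (intro H) auto
      have "min (z - t i) (t (Suc i) - z) \<le> \<bar>tent (t i) (t (Suc i)) z\<bar>"
        using z t0 by (auto simp: tent_def sgn_if)
      then show "min (z - t i) (t (Suc i) - z) \<le> step_dist t n z"
        using step_dist_ge_tent[OF that, of t z] by linarith
    qed (use False tm[of i "Suc i"] in \<open>auto simp: c_def\<close>)
    then show ?thesis using False by (simp add: c_def)
  qed
  have c0: "c 0 = 0" and cn: "c n = x"
    using x t(2) by (auto simp: c_def)
  have "x\<^sup>2 = (\<Sum>i<n. c (Suc i) - c i)\<^sup>2"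
    by (simp add: sum_lessThan_telescope c0 cn)
  also have "\<dots> \<le> (\<Sum>i<n. (c (Suc i) - c i)\<^sup>2) * card {..<n}"
    by (rule sum_squared_le_sum_of_squares)
  also have "\<dots> \<le> (\<Sum>i<n. 4 * (H (c (Suc i)) - H (c i))) * card {..<n}"
    using piece by (intro mult_right_mono sum_mono) (auto simp: field_simps)
  also have "(\<Sum>i<n. 4 * (H (c (Suc i)) - H (c i))) = 4 * H x"
    unfolding sum_distrib_left[symmetric] sum_lessThan_telescope[of "\<lambda>i. H (c i)"]
    by (simp add: c0 cn H0)
  finally show ?thesis by (simp add: mult_ac)
qed

section \<open>Disjointly supported families and the choice of thresholds\<close>

lemma sum_square_orthogonal:
  fixes a :: "'i \<Rightarrow> real"
  assumes "finite J" "\<And>i j. i \<in> J \<Longrightarrow> j \<in> J \<Longrightarrow> i \<noteq> j \<Longrightarrow> a i * a j = 0"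
  shows "(\<Sum>j\<in>J. a j)\<^sup>2 = (\<Sum>j\<in>J. (a j)\<^sup>2)"
  using assms
proof (induction J rule: finite_induct)
  case (insert x F)
  have "a x * (\<Sum>j\<in>F. a j) = 0"
    unfolding sum_distrib_left using insert.prems[of x] insert.hyps(2)
    by (intro sum.neutral) (metis insertI1 insertI2)
  then show ?case
    using insert by (simp add: power2_sum)
qed simp

text \<open>At most one \<open>a j\<close> and at most one \<open>b j\<close> are nonzero, so at
  most two differences survive and Cauchy-Schwarz costs only a factor 2, whatever the size of
  \<open>J\<close>.\<close>

lemma sum_diff_square_le:
  fixes a b :: "'i \<Rightarrow> real"
  assumes J: "finite J"
    and a: "\<And>i j. i \<in> J \<Longrightarrow> j \<in> J \<Longrightarrow> i \<noteq> j \<Longrightarrow> a i * a j = 0"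
    and b: "\<And>i j. i \<in> J \<Longrightarrow> j \<in> J \<Longrightarrow> i \<noteq> j \<Longrightarrow> b i * b j = 0"
  shows "(\<Sum>j\<in>J. a j - b j)\<^sup>2 \<le> 2 * (\<Sum>j\<in>J. (a j - b j)\<^sup>2)"
proof -
  define S where "S c = {j \<in> J. c j \<noteq> 0}" for c :: "'i \<Rightarrow> real"
  have card: "card (S c) \<le> 1" if "\<And>i j. i \<in> J \<Longrightarrow> j \<in> J \<Longrightarrow> i \<noteq> j \<Longrightarrow> c i * c j = 0" for c
  proof -
    have "\<forall>i\<in>S c. \<forall>j\<in>S c. i = j"
      using that unfolding S_def by fastforce
    then show ?thesis using J by (simp add: card_le_Suc0_iff_eq S_def)
  qed
  have ca: "card (S a) \<le> 1" "card (S b) \<le> 1"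
    using card[of a] card[of b] a b by blast+
  let ?U = "S a \<union> S b"
  have U: "?U \<subseteq> J" "finite ?U" "card ?U \<le> 2"
    using J ca card_Un_le[of "S a" "S b"] by (auto simp: S_def)
  have "(\<Sum>j\<in>J. a j - b j) = (\<Sum>j\<in>?U. a j - b j)"
    using J U by (intro sum.mono_neutral_right) (auto simp: S_def)
  then have "(\<Sum>j\<in>J. a j - b j)\<^sup>2 \<le> (\<Sum>j\<in>?U. (a j - b j)\<^sup>2) * card ?U"
    by (simp add: sum_squared_le_sum_of_squares)
  also have "\<dots> \<le> (\<Sum>j\<in>J. (a j - b j)\<^sup>2) * 2"
    using J U by (intro mult_mono sum_mono2 sum_nonneg) auto
  finally show ?thesis by simp
qed

text \<open>Both \<open>sgn\<close> and the shrinking map \<open>x - m * sgn x\<close> are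
  nondecreasing on the reals that are zero or at distance at least \<open>m\<close> from zero. The
  two differences therefore have compatible signs and their absolute values add.\<close>

lemma abs_diff_shrink:
  fixes a b m :: real
  assumes "m > 0" "a = 0 \<or> m \<le> \<bar>a\<bar>" "b = 0 \<or> m \<le> \<bar>b\<bar>"
  shows "\<bar>a - b\<bar> = \<bar>(a - m * sgn a) - (b - m * sgn b)\<bar> + m * \<bar>sgn a - sgn b\<bar>"
  using assms
  by (cases a "0 :: real" rule: linorder_cases; cases b "0 :: real" rule: linorder_cases) auto

text \<open>In the application \<open>m a b\<close> is the mass of the tent over
  \<open>[a, b]\<close> and \<open>M\<close> the maximum of |f|. The disjunction is the invariant of
  the greedy choice.\<close>

lemma ex_thresholds:
  fixes m :: "real \<Rightarrow> real \<Rightarrow> real"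
  assumes cont: "\<And>a. continuous_on UNIV (m a)" and diag: "\<And>a. m a a = 0" and "C > 0"
  shows "\<exists>t. mono t \<and> t 0 = 0 \<and> ((\<forall>i<n. m (t i) (t (Suc i)) = C)
    \<or> (M \<le> t n \<and> (\<forall>i<n. m (t i) (t (Suc i)) \<le> C)))"
proof (induction n)
  case 0
  then show ?case by (intro exI[of _ "\<lambda>_. 0"]) (simp add: mono_def)
next
  case (Suc n)
  then obtain t where t: "mono t" "t 0 = 0"
    and alt: "(\<forall>i<n. m (t i) (t (Suc i)) = C) \<or> (M \<le> t n \<and> (\<forall>i<n. m (t i) (t (Suc i)) \<le> C))"
    by blast
  \<comment> \<open>Constant after index \<open>n\<close>, which keeps the extended sequence
    monotone on all naturals.\<close>
  define ext where "ext b i = (if i \<le> n then t i else b)" for b i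
  have mono: "mono (ext b)" if "t n \<le> b" for b
    unfolding mono_def
  proof (intro allI impI)
    fix i j :: nat assume "i \<le> j"
    then show "ext b i \<le> ext b j"
      using t(1) that by (auto simp: ext_def dest: monoD intro: order_trans)
  qed
  have ext0: "ext b 0 = 0" for b using t(2) by (simp add: ext_def)
  have ext_lt: "m (ext b i) (ext b (Suc i)) = (if i = n then m (t n) b else m (t i) (t (Suc i)))"
    if "i < Suc n" for b i
    using that by (auto simp: ext_def)
  have ext_n: "ext b (Suc n) = b" for b by (simp add: ext_def)
  \<comment> \<open>Once \<open>M\<close> is reached, the last threshold is repeated, giving a band
    of mass 0. Otherwise the next threshold is \<open>M\<close> if the mass up to \<open>M\<close>
    is at most \<open>C\<close>, and else the intermediate value theorem yields a band of mass
    exactly \<open>C\<close>.\<close>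
  consider "M \<le> t n" "\<forall>i<n. m (t i) (t (Suc i)) \<le> C"
    | "t n < M" "\<forall>i<n. m (t i) (t (Suc i)) = C" "m (t n) M \<le> C"
    | "t n < M" "\<forall>i<n. m (t i) (t (Suc i)) = C" "C < m (t n) M"
    using alt by force
  then show ?case
  proof cases
    case 1
    then show ?thesis
      using mono[of "t n"] ext0 ext_lt ext_n diag \<open>C > 0\<close> by (intro exI[of _ "ext (t n)"]) auto
  next
    case 2
    then show ?thesis
      using mono[of M] ext0 ext_lt ext_n by (intro exI[of _ "ext M"]) auto
  next
    case 3
    have "\<exists>b\<ge>t n. b \<le> M \<and> m (t n) b = C"
      using 3 diag \<open>C > 0\<close> continuous_on_subset[OF cont, of "{t n..M}"]
      by (intro IVT') auto
    then obtain b where "t n \<le> b" "m (t n) b = C" by blast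
    then show ?thesis
      using mono[of b] ext0 ext_lt ext_n 3(2) by (intro exI[of _ "ext b"]) auto
  qed
qed

section \<open>Energy and eigenvalues of signed graphs\<close>

context signed_graph
begin

text \<open>The signature is unconstrained outside \<open>E\<close>, so the value is a sign only on
  edges; the arguments below split on \<open>w u v = 0\<close>.\<close>

definition edge_sign :: "'v \<Rightarrow> 'v \<Rightarrow> real" where
  "edge_sign u v = real_of_int (\<sigma> {u, v})"

text \<open>Ordered pairs count every edge twice, so this is twice the quadratic form of the
  Laplacian. Hence a normalized eigenfunction has energy twice its eigenvalue.\<close>

definition energy :: "('v \<Rightarrow> real) \<Rightarrow> real" where
  "energy f = (\<Sum>u\<in>UNIV. \<Sum>v\<in>UNIV. w u v * (f u - edge_sign u v * f v)\<^sup>2)"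

text \<open>The conjugate \<open>D^(1/2) L D^(-1/2)\<close> of the signed Laplacian
  \<open>L\<close>, with \<open>D\<close> the degree matrix. It is symmetric, so it has an
  orthonormal eigenbasis.\<close>

definition normalized_laplacian :: "real^'v^'v" where
  "normalized_laplacian = (\<chi> u v. (if u = v then 1 else 0)
     - edge_sign u v * w u v / (sqrt (wdegree w u) * sqrt (wdegree w v)))"

lemma edge_sign_sym: "edge_sign u v = edge_sign v u"
  by (simp add: edge_sign_def insert_commute)

lemma weight_nonneg: "w u v \<ge> 0"
  using weight_pos[of u v] weight_zero[of u v] by force

lemma edge_sign_cases:
  assumes "w u v \<noteq> 0"
  shows "edge_sign u v = 1 \<or> edge_sign u v = - 1"
proof -
  have "\<sigma> {u, v} = 1 \<or> \<sigma> {u, v} = - 1"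
    using assms signature[of "{u, v}"] weight_zero[of u v] by blast
  then show ?thesis by (auto simp: edge_sign_def)
qed

lemma signed_adjacency_nth: "signed_adjacency E w \<sigma> $ u $ v = edge_sign u v * w u v"
  by (simp add: signed_adjacency_def edge_sign_def weight_zero)

lemma sum_weight_left: "(\<Sum>u\<in>UNIV. \<Sum>v\<in>UNIV. w u v * p u) = (\<Sum>u\<in>UNIV. wdegree w u * p u)"
  by (simp add: wdegree_def sum_distrib_right)

lemma sum_weight_right: "(\<Sum>u\<in>UNIV. \<Sum>v\<in>UNIV. w u v * p v) = (\<Sum>u\<in>UNIV. wdegree w u * p u)"
  by (subst sum.swap) (simp add: wdegree_def sum_distrib_right weight_sym)

lemma energy_expand:
  "energy f = 2 * ((\<Sum>u\<in>UNIV. wdegree w u * (f u)\<^sup>2)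
     - (\<Sum>u\<in>UNIV. \<Sum>v\<in>UNIV. edge_sign u v * w u v * f u * f v))"
proof -
  have "w u v * (f u - edge_sign u v * f v)\<^sup>2
      = w u v * (f u)\<^sup>2 + w u v * (f v)\<^sup>2 - 2 * (edge_sign u v * w u v * f u * f v)" for u v
    using edge_sign_cases[of u v]
    by (cases "w u v = 0") (auto simp: power2_eq_square algebra_simps)
  then show ?thesis
    by (simp add: energy_def sum.distrib sum_subtractf sum_weight_left sum_weight_right
        flip: sum_distrib_left)
qed

lemma normalized_laplacian_form:
  assumes "\<And>u. y $ u = sqrt (wdegree w u) * f u"
  shows "y \<bullet> (normalized_laplacian *v y) = energy f / 2"
    and "y \<bullet> y = (\<Sum>u\<in>UNIV. wdegree w u * (f u)\<^sup>2)"
proof -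
  have pos: "sqrt (wdegree w u) > 0" "wdegree w u \<ge> 0" for u
    using wdegree_pos[of u] by auto
  show yy: "y \<bullet> y = (\<Sum>u\<in>UNIV. wdegree w u * (f u)\<^sup>2)"
    using pos(2) by (simp add: inner_vec_def assms power_mult_distrib flip: power2_eq_square)
  have "y \<bullet> (normalized_laplacian *v y)
      = (\<Sum>u\<in>UNIV. \<Sum>v\<in>UNIV. y $ u * ((if u = v then 1 else 0)
          - edge_sign u v * w u v / (sqrt (wdegree w u) * sqrt (wdegree w v))) * y $ v)"
    by (simp add: inner_vec_def matrix_vector_mult_def normalized_laplacian_def sum_distrib_left mult.assoc)
  also have "\<dots> = (\<Sum>u\<in>UNIV. \<Sum>v\<in>UNIV. (if u = v then y $ u * y $ v else 0)
          - edge_sign u v * w u v * f u * f v)"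
  proof (intro sum.cong refl)
    fix u v
    show "y $ u * ((if u = v then 1 else 0)
          - edge_sign u v * w u v / (sqrt (wdegree w u) * sqrt (wdegree w v))) * y $ v
        = (if u = v then y $ u * y $ v else 0) - edge_sign u v * w u v * f u * f v"
      using pos(1)[of u] pos(1)[of v] by (simp add: assms field_simps)
  qed
  also have "\<dots> = y \<bullet> y - (\<Sum>u\<in>UNIV. \<Sum>v\<in>UNIV. edge_sign u v * w u v * f u * f v)"
    by (simp add: sum_subtractf inner_vec_def)
  finally show "y \<bullet> (normalized_laplacian *v y) = energy f / 2"
    by (simp add: energy_expand yy)
qed

lemma signed_laplacian_nth:
  "signed_laplacian E w \<sigma> $ u $ v = (if u = v then 1 else 0) - edge_sign u v * w u v / wdegree w u"
proof -
  let ?D' = "\<chi> u v. if u = v then 1 / wdegree w u else 0"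
  have nz: "wdegree w u \<noteq> 0" for u using wdegree_pos[of u] by simp
  have D: "degree_matrix w ** ?D' = mat 1" "?D' ** degree_matrix w = mat 1"
    by (auto simp: degree_matrix_def matrix_matrix_mult_def mat_def vec_eq_iff nz
        if_distrib[of "\<lambda>x. x * _"] cong: if_cong)
  \<comment> \<open>\<open>matrix_inv\<close> is a choice among two-sided inverses. A witness yields
    its defining property, and associativity then identifies it with \<open>?D'\<close>.\<close>
  then have "\<exists>A'. degree_matrix w ** A' = mat 1 \<and> A' ** degree_matrix w = mat 1"
    by blast
  from someI_ex[OF this] have right_inv: "degree_matrix w ** matrix_inv (degree_matrix w) = mat 1"
    unfolding matrix_inv_def by simp
  have "matrix_inv (degree_matrix w) = (?D' ** degree_matrix w) ** matrix_inv (degree_matrix w)"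
    using D(2) by simp
  also have "\<dots> = ?D' ** (degree_matrix w ** matrix_inv (degree_matrix w))"
    by (rule matrix_mul_assoc[symmetric])
  also have "\<dots> = ?D'"
    by (simp add: right_inv)
  finally have "matrix_inv (degree_matrix w) = ?D'" .
  then show ?thesis
    by (simp add: signed_laplacian_def matrix_matrix_mult_def signed_adjacency_nth mat_def
        if_distrib[of "\<lambda>x. x * _"] cong: if_cong)
qed

lemma spectral_basis:
  obtains e l where "\<And>i j. e i \<bullet> e j = (if i = j then 1 else 0)"
    and "\<And>i::'v. normalized_laplacian *v e i = l i *\<^sub>R e i"
    and "\<And>k. eigval (signed_laplacian E w \<sigma>) k
      = sorted_list_of_multiset (image_mset l (mset_set UNIV)) ! (k - 1)"
proof -
  have "transpose normalized_laplacian = normalized_laplacian"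
    by (auto simp: transpose_def normalized_laplacian_def vec_eq_iff edge_sign_sym weight_sym mult.commute)
  then obtain e l where orth: "\<And>i j. e i \<bullet> e j = (if i = j then 1 else 0)"
    and eig: "\<And>i::'v. normalized_laplacian *v e i = l i *\<^sub>R e i"
    using symmetric_matrix_eigenbasis by blast
  \<comment> \<open>The columns are \<open>D^(-1/2) e i\<close>, with \<open>D\<close> the degree
    matrix: eigenvectors of the signed Laplacian itself.\<close>
  define B where "B = (\<chi> u i. e i $ u / sqrt (wdegree w u))"
  have pos: "sqrt (wdegree w u) > 0" "wdegree w u > 0" for u
    using wdegree_pos[of u] by auto
  have "(\<chi> i u. e i $ u * sqrt (wdegree w u)) ** B = mat 1"
    using orth pos
    by (simp add: B_def matrix_matrix_mult_def mat_def vec_eq_iff inner_vec_def less_imp_neq[symmetric])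
  then have inv: "invertible B"
    using invertible_left_inverse by blast
  have "(signed_laplacian E w \<sigma> ** B) $ u $ i
      = (B ** (\<chi> i j. if i = j then l i else 0)) $ u $ i" for u i
  proof -
    have "(signed_laplacian E w \<sigma> ** B) $ u $ i
        = (\<Sum>v\<in>UNIV. normalized_laplacian $ u $ v * e i $ v / sqrt (wdegree w u))"
      unfolding matrix_matrix_mult_def signed_laplacian_nth normalized_laplacian_def B_def vec_lambda_beta
    proof (intro sum.cong refl)
      fix v
      have d: "wdegree w u = sqrt (wdegree w u) * sqrt (wdegree w u)"
        using pos(2)[of u] by simp
      have h: "edge_sign u v * w u v / wdegree w u * (e i $ v / sqrt (wdegree w v))
        = edge_sign u v * w u v / (sqrt (wdegree w u) * sqrt (wdegree w v)) * e i $ v / sqrt (wdegree w u)"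
        by (subst d)
          (simp only: times_divide_eq_left times_divide_eq_right divide_divide_eq_left mult_ac)
      show "((if u = v then 1 else 0) - edge_sign u v * w u v / wdegree w u) * (e i $ v / sqrt (wdegree w v))
        = ((if u = v then 1 else 0) - edge_sign u v * w u v / (sqrt (wdegree w u) * sqrt (wdegree w v)))
           * e i $ v / sqrt (wdegree w u)"
        unfolding left_diff_distrib diff_divide_distrib h by simp
    qed
    also have "\<dots> = (normalized_laplacian *v e i) $ u / sqrt (wdegree w u)"
      by (simp add: matrix_vector_mult_def sum_divide_distrib)
    also have "\<dots> = (B ** (\<chi> i j. if i = j then l i else 0)) $ u $ i"
      by (simp add: eig B_def matrix_matrix_mult_def if_distrib[of "\<lambda>x. _ * x"] cong: if_cong)
    finally show ?thesis .
  qed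
  then have "signed_laplacian E w \<sigma> ** B = B ** (\<chi> i j. if i = j then l i else 0)"
    by (simp add: vec_eq_iff)
  from that[OF orth eig eigval_diagonalizable[OF inv this]] show ?thesis .
qed

lemma first_eigenfunction:
  obtains f where "(\<Sum>u\<in>UNIV. wdegree w u * (f u)\<^sup>2) = 1"
    and "energy f = 2 * eigval (signed_laplacian E w \<sigma>) 1"
proof -
  obtain e l where orth: "\<And>i j. e i \<bullet> e j = (if i = j then 1 else 0)"
    and eig: "\<And>i::'v. normalized_laplacian *v e i = l i *\<^sub>R e i"
    and ev: "\<And>k. eigval (signed_laplacian E w \<sigma>) k
      = sorted_list_of_multiset (image_mset l (mset_set UNIV)) ! (k - 1)"
    using spectral_basis by blast
  let ?xs = "sorted_list_of_multiset (image_mset l (mset_set UNIV))"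
  have "length ?xs = CARD('v)"
    by (metis mset_sorted_list_of_multiset size_image_mset size_mset size_mset_set)
  then have "?xs ! 0 \<in> set ?xs" by (intro nth_mem) simp
  then obtain i where i: "l i = eigval (signed_laplacian E w \<sigma>) 1"
    by (auto simp: ev)
  define f where "f u = e i $ u / sqrt (wdegree w u)" for u
  have "e i $ u = sqrt (wdegree w u) * f u" for u
    using wdegree_pos[of u] by (simp add: f_def)
  from normalized_laplacian_form[OF this]
  show ?thesis
    using that[of f] orth[of i i] by (simp add: eig i)
qed

text \<open>Test functions with disjoint supports stay orthogonal after scaling by the square roots
  of the degrees. They span a space of dimension \<open>card J\<close> on which the Rayleigh
  quotient is at most \<open>t\<close>, and \<open>card_eigenvalues_ge_dim\<close> applies. The
  factor 2 reflects the ordered pairs in \<open>energy\<close>.\<close>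

lemma eigval_le_of_orthogonal_family:
  fixes \<phi> :: "'i \<Rightarrow> 'v \<Rightarrow> real"
  assumes k: "k \<in> {1..CARD('v)}" and J: "finite J" "k \<le> card J"
    and pos: "\<And>j. j \<in> J \<Longrightarrow> (\<Sum>u\<in>UNIV. wdegree w u * (\<phi> j u)\<^sup>2) > 0"
    and orth: "\<And>i j u. i \<in> J \<Longrightarrow> j \<in> J \<Longrightarrow> i \<noteq> j \<Longrightarrow> \<phi> i u * \<phi> j u = 0"
    and le: "\<And>c. energy (\<lambda>u. \<Sum>j\<in>J. c j * \<phi> j u)
      \<le> 2 * t * (\<Sum>u\<in>UNIV. wdegree w u * (\<Sum>j\<in>J. c j * \<phi> j u)\<^sup>2)"
  shows "eigval (signed_laplacian E w \<sigma>) k \<le> t"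
proof -
  obtain e l where e: "\<And>i j. e i \<bullet> e j = (if i = j then 1 else 0)"
    "\<And>i::'v. normalized_laplacian *v e i = l i *\<^sub>R e i"
    and ev: "\<And>k. eigval (signed_laplacian E w \<sigma>) k
      = sorted_list_of_multiset (image_mset l (mset_set UNIV)) ! (k - 1)"
    using spectral_basis by blast
  define y :: "'i \<Rightarrow> real^'v" where "y j = (\<chi> u. sqrt (wdegree w u) * \<phi> j u)" for j
  have y_orth: "y i \<bullet> y j = 0" if "i \<in> J" "j \<in> J" "i \<noteq> j" for i j
  proof -
    have "y i \<bullet> y j = (\<Sum>u\<in>UNIV. sqrt (wdegree w u) * sqrt (wdegree w u) * (\<phi> i u * \<phi> j u))"
      by (simp add: inner_vec_def y_def mult_ac)
    also have "\<dots> = 0"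
      by (simp only: orth[OF that]) simp
    finally show ?thesis .
  qed
  have y_pos: "y j \<bullet> y j > 0" if "j \<in> J" for j
    using pos[OF that] normalized_laplacian_form(2)[of "y j" "\<phi> j"] by (simp add: y_def)
  have inj: "inj_on y J"
    by (rule inj_onI) (metis less_irrefl y_orth y_pos)
  have "independent (y ` J)"
  proof (rule pairwise_orthogonal_independent)
    show "pairwise orthogonal (y ` J)"
      using y_orth by (force simp: pairwise_def orthogonal_def)
    show "0 \<notin> y ` J"
      using y_pos by force
  qed
  then have dim: "dim (span (y ` J)) = card J"
    by (simp add: dim_eq_card_independent card_image[OF inj])
  have "z \<bullet> (normalized_laplacian *v z) \<le> t * (z \<bullet> z)" if "z \<in> span (y ` J)" for z
  proof -
    obtain a where "z = (\<Sum>v\<in>y ` J. a v *\<^sub>R v)"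
      using \<open>z \<in> span (y ` J)\<close> J(1) by (auto simp: span_finite)
    then have "z = (\<Sum>j\<in>J. a (y j) *\<^sub>R y j)"
      by (simp add: sum.reindex[OF inj])
    then have "z $ u = sqrt (wdegree w u) * (\<Sum>j\<in>J. a (y j) * \<phi> j u)" for u
      by (simp add: y_def sum_distrib_left mult_ac)
    from normalized_laplacian_form[OF this] show ?thesis
      using le[of "\<lambda>j. a (y j)"] by simp
  qed
  then have "dim (span (y ` J)) \<le> card {i. l i \<le> t}"
    by (intro card_eigenvalues_ge_dim[OF e subspace_span])
  then have "k \<le> card {i. l i \<le> t}"
    using dim J(2) by linarith
  then show ?thesis
    unfolding ev using k by (intro card_ge_imp_sorted_nth_le) auto
qed

lemma eigval_first_le:
  assumes "k \<in> {1..CARD('v)}"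
  shows "eigval (signed_laplacian E w \<sigma>) 1 \<le> eigval (signed_laplacian E w \<sigma>) k"
proof -
  obtain e l where orth: "\<And>i j. e i \<bullet> e j = (if i = j then 1 else 0)"
    and eig: "\<And>i::'v. normalized_laplacian *v e i = l i *\<^sub>R e i"
    and ev: "\<And>k. eigval (signed_laplacian E w \<sigma>) k
      = sorted_list_of_multiset (image_mset l (mset_set UNIV)) ! (k - 1)"
    using spectral_basis by blast
  let ?xs = "sorted_list_of_multiset (image_mset l (mset_set UNIV))"
  have "length ?xs = CARD('v)"
    by (metis mset_sorted_list_of_multiset size_image_mset size_mset size_mset_set)
  then have "?xs ! 0 \<le> ?xs ! (k - 1)"
    using assms by (intro sorted_nth_mono) auto
  then show ?thesis
    by (simp add: ev)
qed

section \<open>The signed Cheeger constant\<close>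

lemma finite_bipartiteness_ratios:
  "finite {signed_bipartiteness_ratio E w \<sigma> \<mu> V1 V2 | V1 V2. V1 \<inter> V2 = {} \<and> V1 \<union> V2 \<noteq> {}}"
  by (rule finite_subset[of _ "(\<lambda>(A, B). signed_bipartiteness_ratio E w \<sigma> \<mu> A B) ` UNIV"]) auto

lemma signed_cheeger_le:
  assumes "V1 \<inter> V2 = {}" "V1 \<union> V2 \<noteq> {}"
  shows "signed_cheeger E w \<sigma> \<mu> \<le> signed_bipartiteness_ratio E w \<sigma> \<mu> V1 V2"
  unfolding signed_cheeger_def
  using assms by (intro Min_le finite_bipartiteness_ratios) blast

lemma signed_cheeger_nonneg: "signed_cheeger E w \<sigma> (wdegree w) \<ge> 0"
proof -
  let ?S = "{signed_bipartiteness_ratio E w \<sigma> (wdegree w) V1 V2 | V1 V2. V1 \<inter> V2 = {} \<and> V1 \<union> V2 \<noteq> {}}"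
  have "signed_bipartiteness_ratio E w \<sigma> (wdegree w) UNIV {} \<in> ?S"
    by (simp, intro exI[of _ UNIV] exI[of _ "{}"]) simp
  then have "signed_cheeger E w \<sigma> (wdegree w) \<in> ?S"
    unfolding signed_cheeger_def by (intro Min_in finite_bipartiteness_ratios) auto
  moreover have "signed_bipartiteness_ratio E w \<sigma> (wdegree w) A B \<ge> 0" for A B
    unfolding signed_bipartiteness_ratio_def signed_edge_weight_def edge_weight_def vol_def
    using weight_nonneg wdegree_pos
    by (intro divide_nonneg_nonneg add_nonneg_nonneg sum_nonneg mult_nonneg_nonneg)
      (auto intro: less_imp_le)
  ultimately show ?thesis by auto
qed

lemma signed_edge_weight_UNIV:
  assumes "c = 1 \<or> c = - 1"
  shows "signed_edge_weight E w \<sigma> c A B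
    = (\<Sum>u\<in>UNIV. \<Sum>v\<in>UNIV. if u \<in> A \<and> v \<in> B \<and> edge_sign u v = of_int c then w u v else 0)"
proof -
  have inner: "(\<Sum>v\<in>{v \<in> B. {u, v} \<in> E \<and> \<sigma> {u, v} = c}. w u v)
      = (\<Sum>v\<in>UNIV. if v \<in> B \<and> edge_sign u v = of_int c then w u v else 0)" for u
  proof -
    have "(\<Sum>v\<in>{v \<in> B. {u, v} \<in> E \<and> \<sigma> {u, v} = c}. w u v)
        = (\<Sum>v\<in>{v. v \<in> B \<and> edge_sign u v = of_int c}. w u v)"
      by (rule sum.mono_neutral_left) (auto simp: edge_sign_def, metis weight_zero)
    then show ?thesis by (simp add: sum.If_cases)
  qed
  have "(\<Sum>u\<in>A. g u) = (\<Sum>u\<in>UNIV. if u \<in> A then g u else 0)" for g :: "'v \<Rightarrow> real"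
    by (simp add: sum.If_cases)
  then show ?thesis
    unfolding signed_edge_weight_def inner by (auto intro!: sum.cong)
qed

lemma edge_weight_UNIV:
  "edge_weight w A B = (\<Sum>u\<in>UNIV. \<Sum>v\<in>UNIV. if u \<in> A \<and> v \<in> B then w u v else 0)"
proof -
  have restrict: "(\<Sum>u\<in>C. g u) = (\<Sum>u\<in>UNIV. if u \<in> C then g u else 0)" for C and g :: "'v \<Rightarrow> real"
    by (simp add: sum.If_cases)
  show ?thesis
    unfolding edge_weight_def restrict[where C = B] by (subst restrict) (auto intro!: sum.cong)
qed

text \<open>The linear Cheeger bound for functions with values -1, 0 and 1: the pair of sets where
  \<open>y\<close> is positive and where it is negative competes in the minimum.\<close>

lemma signed_cheeger_mult_sgn_le:
  fixes y :: "'v \<Rightarrow> real"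
  shows "signed_cheeger E w \<sigma> (wdegree w) * (\<Sum>u\<in>UNIV. wdegree w u * \<bar>sgn (y u)\<bar>)
    \<le> (\<Sum>u\<in>UNIV. \<Sum>v\<in>UNIV. w u v * \<bar>sgn (y u) - edge_sign u v * sgn (y v)\<bar>) / 2"
proof (cases "\<forall>u. y u = 0")
  case False
  define A where "A = {u. y u > 0}"
  define B where "B = {u. y u < 0}"
  have AB: "A \<inter> B = {}" "A \<union> B \<noteq> {}"
    using False by (auto simp: A_def B_def neq_iff)
  define I where "I P = (\<Sum>u\<in>UNIV. \<Sum>v\<in>UNIV. if P u v then w u v else 0)" for P
  have I_swap: "I (\<lambda>u v. P v u) = I P" for P
    unfolding I_def by (subst sum.swap, intro sum.cong refl) (simp add: weight_sym)
  define P1 where "P1 = (\<lambda>u v. u \<in> A \<and> v \<in> B \<and> edge_sign u v = 1)"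
  define P2 where "P2 = (\<lambda>u v. u \<in> A \<and> v \<in> A \<and> edge_sign u v = - 1)"
  define P3 where "P3 = (\<lambda>u v. u \<in> B \<and> v \<in> B \<and> edge_sign u v = - 1)"
  define P4 where "P4 = (\<lambda>u v. u \<in> A \<union> B \<and> v \<in> - (A \<union> B))"
  have num: "2 * signed_edge_weight E w \<sigma> 1 A B + signed_edge_weight E w \<sigma> (- 1) A A
      + signed_edge_weight E w \<sigma> (- 1) B B + edge_weight w (A \<union> B) (- (A \<union> B))
      = 2 * I P1 + I P2 + I P3 + I P4"
    by (simp add: signed_edge_weight_UNIV edge_weight_UNIV I_def P1_def P2_def P3_def P4_def)
  have vol: "vol (wdegree w) (A \<union> B) = (\<Sum>u\<in>UNIV. wdegree w u * \<bar>sgn (y u)\<bar>)"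
  proof -
    have "(\<Sum>u\<in>A \<union> B. wdegree w u) = (\<Sum>u\<in>UNIV. if u \<in> A \<union> B then wdegree w u else 0)"
      by (simp add: sum.If_cases Un_def)
    also have "\<dots> = (\<Sum>u\<in>UNIV. wdegree w u * \<bar>sgn (y u)\<bar>)"
      by (intro sum.cong) (auto simp: A_def B_def sgn_if)
    finally show ?thesis by (simp add: vol_def)
  qed
  have vol_pos: "vol (wdegree w) (A \<union> B) > 0"
    unfolding vol_def using AB(2) wdegree_pos by (intro sum_pos) auto
  \<comment> \<open>The difference is 2 on pairs that violate the sign pattern and 1 on boundary
    pairs. \<open>P1\<close> and \<open>P4\<close> are not symmetric in their arguments, so both
    orders occur.\<close>
  have "w u v * \<bar>sgn (y u) - edge_sign u v * sgn (y v)\<bar>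
      = 2 * (if P1 u v then w u v else 0) + 2 * (if P1 v u then w u v else 0)
        + 2 * (if P2 u v then w u v else 0) + 2 * (if P3 u v then w u v else 0)
        + (if P4 u v then w u v else 0) + (if P4 v u then w u v else 0)" for u v
  proof (cases "w u v = 0")
    case False
    then have "edge_sign u v = 1 \<or> edge_sign u v = - 1" by (rule edge_sign_cases)
    moreover have "edge_sign v u = edge_sign u v" by (rule edge_sign_sym)
    ultimately show ?thesis
      by (auto simp: P1_def P2_def P3_def P4_def A_def B_def sgn_if)
  qed simp
  then have "(\<Sum>u\<in>UNIV. \<Sum>v\<in>UNIV. w u v * \<bar>sgn (y u) - edge_sign u v * sgn (y v)\<bar>)
      = 2 * I P1 + 2 * I (\<lambda>u v. P1 v u) + 2 * I P2 + 2 * I P3 + I P4 + I (\<lambda>u v. P4 v u)"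
    by (simp add: I_def sum.distrib sum_distrib_left)
  also have "\<dots> = 2 * (2 * I P1 + I P2 + I P3 + I P4)"
    unfolding I_swap[of P1] I_swap[of P4] by simp
  finally have "signed_bipartiteness_ratio E w \<sigma> (wdegree w) A B * vol (wdegree w) (A \<union> B)
      = (\<Sum>u\<in>UNIV. \<Sum>v\<in>UNIV. w u v * \<bar>sgn (y u) - edge_sign u v * sgn (y v)\<bar>) / 2"
    unfolding signed_bipartiteness_ratio_def num using vol_pos by simp
  moreover have "signed_cheeger E w \<sigma> (wdegree w) * vol (wdegree w) (A \<union> B)
      \<le> signed_bipartiteness_ratio E w \<sigma> (wdegree w) A B * vol (wdegree w) (A \<union> B)"
    using signed_cheeger_le[OF AB] vol_pos by (intro mult_right_mono) auto
  ultimately show ?thesis by (simp add: vol)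
qed simp

text \<open>Induction on the size of the support: with \<^term>\<open>m\<close> the least nonzero value of
  \<^term>\<open>\<lambda>u. \<bar>y u\<bar>\<close>, both sides are additive along
  \<^term>\<open>y = (\<lambda>u. (y u - m * sgn (y u)) + m * sgn (y u))\<close>. This replaces the coarea formula.\<close>

lemma signed_cheeger_mult_abs_le:
  fixes y :: "'v \<Rightarrow> real"
  shows "signed_cheeger E w \<sigma> (wdegree w) * (\<Sum>u\<in>UNIV. wdegree w u * \<bar>y u\<bar>)
    \<le> (\<Sum>u\<in>UNIV. \<Sum>v\<in>UNIV. w u v * \<bar>y u - edge_sign u v * y v\<bar>) / 2"
proof (induction "card {u. y u \<noteq> 0}" arbitrary: y rule: less_induct)
  case less
  show ?case
  proof (cases "\<forall>u. y u = 0")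
    case False
    define m where "m = Min ((\<lambda>u. \<bar>y u\<bar>) ` {u. y u \<noteq> 0})"
    have m_in: "m \<in> (\<lambda>u. \<bar>y u\<bar>) ` {u. y u \<noteq> 0}"
      unfolding m_def using False by (intro Min_in) auto
    then obtain u0 where u0: "y u0 \<noteq> 0" "\<bar>y u0\<bar> = m" by auto
    have m_le: "y u = 0 \<or> m \<le> \<bar>y u\<bar>" for u
      unfolding m_def by (cases "y u = 0") (auto intro: Min_le)
    have m_pos: "m > 0" using u0 by auto
    define z where "z u = y u - m * sgn (y u)" for u
    have "z u0 = 0"
      using u0 by (auto simp: z_def sgn_if abs_if split: if_splits)
    moreover have "{u. z u \<noteq> 0} \<subseteq> {u. y u \<noteq> 0}"
      by (auto simp: z_def)
    ultimately have "{u. z u \<noteq> 0} \<subset> {u. y u \<noteq> 0}"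
      using u0(1) by blast
    then have "card {u. z u \<noteq> 0} < card {u. y u \<noteq> 0}"
      by (intro psubset_card_mono) auto
    from less.hyps[OF this]
    have IH: "signed_cheeger E w \<sigma> (wdegree w) * (\<Sum>u\<in>UNIV. wdegree w u * \<bar>z u\<bar>)
      \<le> (\<Sum>u\<in>UNIV. \<Sum>v\<in>UNIV. w u v * \<bar>z u - edge_sign u v * z v\<bar>) / 2" .
    have "wdegree w u * \<bar>y u\<bar> = wdegree w u * \<bar>z u\<bar> + m * (wdegree w u * \<bar>sgn (y u)\<bar>)" for u
    proof -
      have "\<bar>y u\<bar> = \<bar>z u\<bar> + m * \<bar>sgn (y u)\<bar>"
        using m_le[of u] m_pos by (auto simp: z_def sgn_if abs_if)
      then show ?thesis by (simp add: algebra_simps)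
    qed
    then have left: "(\<Sum>u\<in>UNIV. wdegree w u * \<bar>y u\<bar>)
      = (\<Sum>u\<in>UNIV. wdegree w u * \<bar>z u\<bar>) + m * (\<Sum>u\<in>UNIV. wdegree w u * \<bar>sgn (y u)\<bar>)"
      by (simp only: sum.distrib sum_distrib_left)
    have "w u v * \<bar>y u - edge_sign u v * y v\<bar> = w u v * \<bar>z u - edge_sign u v * z v\<bar>
        + m * (w u v * \<bar>sgn (y u) - edge_sign u v * sgn (y v)\<bar>)" for u v
    proof (cases "w u v = 0")
      case False
      have "\<bar>y u - edge_sign u v * y v\<bar> = \<bar>z u - edge_sign u v * z v\<bar>
        + m * \<bar>sgn (y u) - edge_sign u v * sgn (y v)\<bar>"
        using edge_sign_cases[OF False] abs_diff_shrink[OF m_pos m_le[of u], of "edge_sign u v * y v"]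
          m_le[of v]
        by (auto simp: z_def sgn_minus)
      then show ?thesis by (simp add: algebra_simps)
    qed simp
    then have right: "(\<Sum>u\<in>UNIV. \<Sum>v\<in>UNIV. w u v * \<bar>y u - edge_sign u v * y v\<bar>)
      = (\<Sum>u\<in>UNIV. \<Sum>v\<in>UNIV. w u v * \<bar>z u - edge_sign u v * z v\<bar>)
        + m * (\<Sum>u\<in>UNIV. \<Sum>v\<in>UNIV. w u v * \<bar>sgn (y u) - edge_sign u v * sgn (y v)\<bar>)"
      by (simp only: sum.distrib sum_distrib_left)
    have "m * (signed_cheeger E w \<sigma> (wdegree w) * (\<Sum>u\<in>UNIV. wdegree w u * \<bar>sgn (y u)\<bar>))
      \<le> m * ((\<Sum>u\<in>UNIV. \<Sum>v\<in>UNIV. w u v * \<bar>sgn (y u) - edge_sign u v * sgn (y v)\<bar>) / 2)"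
      using signed_cheeger_mult_sgn_le m_pos by (intro mult_left_mono) auto
    with IH show ?thesis
      unfolding left right by (simp add: algebra_simps add_divide_distrib)
  qed simp
qed

section \<open>Energies of the pieces and the improved Cheeger bound\<close>

lemma energy_nonneg: "energy f \<ge> 0"
  unfolding energy_def using weight_nonneg by (intro sum_nonneg mult_nonneg_nonneg) auto

lemma sum_energy_tent_le:
  assumes "mono t" "t 0 = 0"
  shows "(\<Sum>i<n. energy (\<lambda>u. tent (t i) (t (Suc i)) (f u))) \<le> energy f"
proof -
  have "(\<Sum>i<n. energy (\<lambda>u. tent (t i) (t (Suc i)) (f u)))
      = (\<Sum>u\<in>UNIV. \<Sum>v\<in>UNIV. \<Sum>i<n. w u v *
          (tent (t i) (t (Suc i)) (f u) - edge_sign u v * tent (t i) (t (Suc i)) (f v))\<^sup>2)"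
    unfolding energy_def by (subst sum.swap, intro sum.cong refl, rule sum.swap)
  also have "\<dots> \<le> energy f"
    unfolding energy_def
  proof (intro sum_mono)
    fix u v
    show "(\<Sum>i<n. w u v *
          (tent (t i) (t (Suc i)) (f u) - edge_sign u v * tent (t i) (t (Suc i)) (f v))\<^sup>2)
        \<le> w u v * (f u - edge_sign u v * f v)\<^sup>2"
    proof (cases "w u v = 0")
      case False
      \<comment> \<open>Oddness of the tent carries the edge sign inside, so the scalar estimate
        applies to \<open>f u\<close> and \<open>edge_sign u v * f v\<close>.\<close>
      have "edge_sign u v * tent a b (f v) = tent a b (edge_sign u v * f v)" for a b
        using edge_sign_cases[OF False] by (auto simp: tent_uminus)
      then show ?thesis
        using sum_tent_diff_square_le[OF assms, of "f u" "edge_sign u v * f v"] weight_nonneg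
        by (simp add: mult_left_mono flip: sum_distrib_left)
    qed simp
  qed
  finally show ?thesis .
qed

lemma eigval_le_of_tent_masses:
  assumes k: "k \<in> {1..CARD('v)}" and t: "mono t" "t 0 = 0" and "C > 0"
    and mass: "\<And>i. i < 2 * k \<Longrightarrow>
      (\<Sum>u\<in>UNIV. wdegree w u * (tent (t i) (t (Suc i)) (f u))\<^sup>2) = C"
  shows "eigval (signed_laplacian E w \<sigma>) k \<le> energy f / (real k * C)"
proof -
  define \<phi> where "\<phi> i u = tent (t i) (t (Suc i)) (f u)" for i u
  \<comment> \<open>The energies of the \<open>2 * k\<close> tents sum to at most
    \<open>energy f\<close>, so at most \<open>k\<close> of them can exceed
    \<open>energy f / real k\<close>. At least \<open>k\<close> remain in \<open>J\<close> as test
    functions.\<close>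
  define J where "J = {i\<in>{..<2 * k}. energy (\<phi> i) \<le> energy f / real k}"
  define B where "B = {i\<in>{..<2 * k}. \<not> energy (\<phi> i) \<le> energy f / real k}"
  have k1: "real k > 0" "k > 0" using k by auto
  have "card J \<ge> k"
  proof (rule ccontr)
    assume "\<not> card J \<ge> k"
    moreover have "card J + card B = 2 * k"
    proof -
      have "J \<union> B = {..<2 * k}" "J \<inter> B = {}" "finite J" "finite B"
        by (auto simp: J_def B_def)
      then show ?thesis by (metis card_Un_disjoint card_lessThan)
    qed
    ultimately have B: "k < card B" by linarith
    then have "B \<noteq> {}" by auto
    moreover have "finite B" by (simp add: B_def)
    ultimately have "(\<Sum>i\<in>B. energy f / real k) < (\<Sum>i\<in>B. energy (\<phi> i))"
      by (intro sum_strict_mono) (auto simp: B_def)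
    also have "\<dots> \<le> (\<Sum>i<2 * k. energy (\<phi> i))"
      using energy_nonneg by (intro sum_mono2) (auto simp: B_def)
    also have "\<dots> \<le> energy f"
      unfolding \<phi>_def by (rule sum_energy_tent_le[OF t])
    finally have "real (card B) * (energy f / real k) < energy f" by simp
    moreover have "real k * (energy f / real k) \<le> real (card B) * (energy f / real k)"
      using B energy_nonneg[of f] by (intro mult_right_mono) auto
    ultimately show False using k1 by simp
  qed
  have J: "finite J" "J \<subseteq> {..<2 * k}" by (auto simp: J_def)
  have orth: "\<phi> i u * \<phi> j u = 0" if "i \<noteq> j" for i j u
    unfolding \<phi>_def using that by (rule tent_disjoint[OF t(1)])
  show ?thesis
  proof (rule eigval_le_of_orthogonal_family[OF k J(1) \<open>card J \<ge> k\<close>, where \<phi> = \<phi>])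
    show "(\<Sum>u\<in>UNIV. wdegree w u * (\<phi> j u)\<^sup>2) > 0" if "j \<in> J" for j
      using mass[of j] that J(2) \<open>C > 0\<close> by (auto simp: \<phi>_def)
    show "\<phi> i u * \<phi> j u = 0" if "i \<noteq> j" for i j u
      by (rule orth[OF that])
    fix c :: "nat \<Rightarrow> real"
    have "(\<Sum>u\<in>UNIV. wdegree w u * (\<Sum>j\<in>J. c j * \<phi> j u)\<^sup>2)
        = (\<Sum>u\<in>UNIV. \<Sum>j\<in>J. (c j)\<^sup>2 * (wdegree w u * (\<phi> j u)\<^sup>2))"
    proof (intro sum.cong refl)
      fix u
      have "(\<Sum>j\<in>J. c j * \<phi> j u)\<^sup>2 = (\<Sum>j\<in>J. (c j * \<phi> j u)\<^sup>2)"
        using orth by (intro sum_square_orthogonal J(1)) (simp add: mult.assoc mult.left_commute)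
      then show "wdegree w u * (\<Sum>j\<in>J. c j * \<phi> j u)\<^sup>2
          = (\<Sum>j\<in>J. (c j)\<^sup>2 * (wdegree w u * (\<phi> j u)\<^sup>2))"
        by (simp add: sum_distrib_left power_mult_distrib mult_ac)
    qed
    also have "\<dots> = (\<Sum>j\<in>J. (c j)\<^sup>2 * (\<Sum>u\<in>UNIV. wdegree w u * (\<phi> j u)\<^sup>2))"
      by (subst sum.swap) (simp add: sum_distrib_left)
    also have "\<dots> = (\<Sum>j\<in>J. (c j)\<^sup>2 * C)"
      using mass J(2) by (intro sum.cong) (auto simp: \<phi>_def)
    finally have norm: "(\<Sum>u\<in>UNIV. wdegree w u * (\<Sum>j\<in>J. c j * \<phi> j u)\<^sup>2) = (\<Sum>j\<in>J. (c j)\<^sup>2) * C"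
      by (simp add: sum_distrib_right)
    have "energy (\<lambda>u. \<Sum>j\<in>J. c j * \<phi> j u)
        \<le> (\<Sum>u\<in>UNIV. \<Sum>v\<in>UNIV. \<Sum>j\<in>J. 2 * (c j)\<^sup>2 * (w u v * (\<phi> j u - edge_sign u v * \<phi> j v)\<^sup>2))"
      unfolding energy_def
    proof (intro sum_mono)
      fix u v
      have "((\<Sum>j\<in>J. c j * \<phi> j u) - edge_sign u v * (\<Sum>j\<in>J. c j * \<phi> j v))\<^sup>2
          = (\<Sum>j\<in>J. c j * \<phi> j u - edge_sign u v * (c j * \<phi> j v))\<^sup>2"
        by (simp add: sum_subtractf sum_distrib_left)
      \<comment> \<open>Each endpoint lies in the support of at most one tent, so an edge meets at
        most two pieces.\<close>
      also have "\<dots> \<le> 2 * (\<Sum>j\<in>J. (c j * \<phi> j u - edge_sign u v * (c j * \<phi> j v))\<^sup>2)"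
      proof (intro sum_diff_square_le J(1))
        fix i j :: nat assume "i \<noteq> j"
        then have "\<phi> i u * \<phi> j u = 0" "\<phi> i v * \<phi> j v = 0" by (simp_all add: orth)
        then show "c i * \<phi> i u * (c j * \<phi> j u) = 0"
          and "edge_sign u v * (c i * \<phi> i v) * (edge_sign u v * (c j * \<phi> j v)) = 0"
          by auto
      qed
      also have "\<dots> = (\<Sum>j\<in>J. 2 * (c j)\<^sup>2 * (\<phi> j u - edge_sign u v * \<phi> j v)\<^sup>2)"
        by (simp add: sum_distrib_left power2_eq_square algebra_simps)
      finally show "w u v * ((\<Sum>j\<in>J. c j * \<phi> j u) - edge_sign u v * (\<Sum>j\<in>J. c j * \<phi> j v))\<^sup>2
          \<le> (\<Sum>j\<in>J. 2 * (c j)\<^sup>2 * (w u v * (\<phi> j u - edge_sign u v * \<phi> j v)\<^sup>2))"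
        using mult_left_mono[OF _ weight_nonneg[of u v], of _
            "\<Sum>j\<in>J. 2 * (c j)\<^sup>2 * (\<phi> j u - edge_sign u v * \<phi> j v)\<^sup>2"]
        by (simp only: sum_distrib_left mult.left_commute[of "w u v"])
    qed
    also have "\<dots> = (\<Sum>j\<in>J. 2 * (c j)\<^sup>2 * energy (\<phi> j))"
      unfolding energy_def sum_distrib_left by (rule trans[OF sum.cong[OF refl sum.swap] sum.swap])
    also have "\<dots> \<le> (\<Sum>j\<in>J. 2 * (c j)\<^sup>2 * (energy f / real k))"
      by (intro sum_mono mult_left_mono) (auto simp: J_def)
    also have "\<dots> = 2 * (\<Sum>j\<in>J. (c j)\<^sup>2) * (energy f / real k)"
      by (simp only: sum_distrib_left sum_distrib_right)
    also have "\<dots> = 2 * (energy f / (real k * C)) * ((\<Sum>j\<in>J. (c j)\<^sup>2) * C)"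
      using \<open>C > 0\<close> by simp
    finally show "energy (\<lambda>u. \<Sum>j\<in>J. c j * \<phi> j u)
      \<le> 2 * (energy f / (real k * C)) * (\<Sum>u\<in>UNIV. wdegree w u * (\<Sum>j\<in>J. c j * \<phi> j u)\<^sup>2)"
      unfolding norm .
  qed
qed

text \<open>The two sides of the linear Cheeger bound for the composite of \<open>H\<close> and
  \<open>f\<close> are estimated separately: from below by \<open>primitive_ge_square\<close> and
  the normalization of \<open>f\<close>, from above by \<open>primitive_diff_le\<close>, the energy
  and the distance to the thresholds.\<close>

lemma signed_cheeger_le_of_step_approximation:
  assumes t: "mono t" "t 0 = 0" and f_le: "\<And>u. \<bar>f u\<bar> \<le> t n"
    and norm: "(\<Sum>u\<in>UNIV. wdegree w u * (f u)\<^sup>2) = 1"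
    and R: "energy f = 2 * R" "R > 0" and "s > 0"
    and approx: "(\<Sum>u\<in>UNIV. wdegree w u * (step_dist t n (f u))\<^sup>2) \<le> 2 * s\<^sup>2 / R"
  shows "signed_cheeger E w \<sigma> (wdegree w) \<le> 4 * real n * (R / 2 + s)"
proof -
  let ?\<eta> = "step_dist t n"
  have t_nn: "0 \<le> t n" using t monoD[OF t(1), of 0 n] by simp
  have lip: "dist (?\<eta> x) (?\<eta> y) \<le> 1 * dist x y" for x y
    using step_dist_lipschitz[OF t, of n x y] by (simp add: dist_real_def)
  have "continuous_on UNIV ?\<eta>"
    by (rule lipschitz_on_continuous_on[of 1]) (auto intro!: lipschitz_onI simp: lip[simplified])
  \<comment> \<open>The extra 1 puts all values of \<open>f\<close> in the interior, where
    \<open>H\<close> is differentiable.\<close>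
  then obtain H where odd: "\<And>x. H (- x) = - H x"
    and H: "\<And>x. \<bar>x\<bar> < t n + 1 \<Longrightarrow> (H has_real_derivative ?\<eta> x) (at x)"
    using odd_primitive[of ?\<eta> "t n + 1"] step_dist_uminus by blast
  have H0: "H 0 = 0" using odd[of 0] by simp
  have f_lt: "\<bar>f u\<bar> < t n + 1" for u using f_le[of u] by simp
  have lower: "(f u)\<^sup>2 \<le> 4 * real n * \<bar>H (f u)\<bar>" for u
  proof -
    have "\<bar>f u\<bar>\<^sup>2 \<le> 4 * real n * H \<bar>f u\<bar>"
      by (rule primitive_ge_square[OF t, where K = "t n + 1"]) (use H H0 f_le in auto)
    also have "\<dots> \<le> 4 * real n * \<bar>H (f u)\<bar>"
      using odd[of "f u"] by (intro mult_left_mono) (auto simp: abs_if)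
    finally show ?thesis by simp
  qed
  \<comment> \<open>This weight makes the error terms \<open>\<theta> * R / 2\<close> and
    \<open>2 * s\<^sup>2 / (\<theta> * R)\<close> both equal to \<open>s\<close>, which minimizes
    their sum.\<close>
  define \<theta> where "\<theta> = 2 * s / R"
  have \<theta>: "\<theta> > 0" using R \<open>s > 0\<close> by (simp add: \<theta>_def)
  have upper: "w u v * \<bar>H (f u) - edge_sign u v * H (f v)\<bar>
      \<le> (1 / 2 + \<theta> / 4) * (w u v * (f u - edge_sign u v * f v)\<^sup>2)
        + (1 / (2 * \<theta>)) * (w u v * (?\<eta> (f u))\<^sup>2 + w u v * (?\<eta> (f v))\<^sup>2)" for u v
  proof (cases "w u v = 0")
    case False
    define x where "x = edge_sign u v * f v"
    have x: "edge_sign u v * H (f v) = H x" "\<bar>x\<bar> = \<bar>f v\<bar>" "?\<eta> x = ?\<eta> (f v)"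
      using edge_sign_cases[OF False] odd step_dist_uminus by (auto simp: x_def)
    define D where "D = \<bar>f u - x\<bar>"
    define p where "p = ?\<eta> (f u)"
    define q where "q = ?\<eta> (f v)"
    have "\<bar>H (f u) - H x\<bar> \<le> D * (p + q + D) / 2"
      using primitive_diff_le[OF t H f_lt, of x u] f_lt[of v] x by (simp add: D_def p_def q_def)
    also have "\<dots> \<le> (1 / 2 + \<theta> / 4) * D\<^sup>2 + (1 / (2 * \<theta>)) * (p\<^sup>2 + q\<^sup>2)"
    proof -
      \<comment> \<open>Weighted AM-GM: the gap between the two sides, multiplied by
        \<open>4 * \<theta>\<close>, is a sum of two squares.\<close>
      have "0 \<le> (\<theta> * D - (p + q))\<^sup>2 + (p - q)\<^sup>2" by simp
      also have "\<dots> = 4 * \<theta> * ((1 / 2 + \<theta> / 4) * D\<^sup>2 + (1 / (2 * \<theta>)) * (p\<^sup>2 + q\<^sup>2) - D * (p + q + D) / 2)"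
        using \<theta> by (simp add: power2_eq_square field_simps)
      finally show ?thesis using \<theta> by (simp add: zero_le_mult_iff)
    qed
    finally have "\<bar>H (f u) - edge_sign u v * H (f v)\<bar>
        \<le> (1 / 2 + \<theta> / 4) * (f u - edge_sign u v * f v)\<^sup>2 + (1 / (2 * \<theta>)) * (p\<^sup>2 + q\<^sup>2)"
      by (simp add: x(1) D_def x_def)
    from mult_left_mono[OF this weight_nonneg[of u v]] show ?thesis
      by (simp add: p_def q_def algebra_simps)
  qed simp
  let ?h = "signed_cheeger E w \<sigma> (wdegree w)"
  have "?h = ?h * (\<Sum>u\<in>UNIV. wdegree w u * (f u)\<^sup>2)" by (simp add: norm)
  also have "\<dots> \<le> ?h * (\<Sum>u\<in>UNIV. wdegree w u * (4 * real n * \<bar>H (f u)\<bar>))"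
    using lower signed_cheeger_nonneg wdegree_pos by (intro mult_left_mono sum_mono) (auto intro: less_imp_le)
  also have "\<dots> = 4 * real n * (?h * (\<Sum>u\<in>UNIV. wdegree w u * \<bar>H (f u)\<bar>))"
    by (simp add: sum_distrib_left mult_ac)
  also have "\<dots> \<le> 4 * real n * ((\<Sum>u\<in>UNIV. \<Sum>v\<in>UNIV. w u v * \<bar>H (f u) - edge_sign u v * H (f v)\<bar>) / 2)"
    using signed_cheeger_mult_abs_le by (intro mult_left_mono) auto
  also have "\<dots> \<le> 4 * real n * (R / 2 + s)"
  proof -
    have "(\<Sum>u\<in>UNIV. \<Sum>v\<in>UNIV. w u v * \<bar>H (f u) - edge_sign u v * H (f v)\<bar>)
      \<le> (\<Sum>u\<in>UNIV. \<Sum>v\<in>UNIV. (1 / 2 + \<theta> / 4) * (w u v * (f u - edge_sign u v * f v)\<^sup>2)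
        + (1 / (2 * \<theta>)) * (w u v * (?\<eta> (f u))\<^sup>2 + w u v * (?\<eta> (f v))\<^sup>2))"
      by (intro sum_mono upper)
    also have "\<dots> = (1 / 2 + \<theta> / 4) * energy f
        + (1 / (2 * \<theta>)) * (2 * (\<Sum>u\<in>UNIV. wdegree w u * (?\<eta> (f u))\<^sup>2))"
      by (simp only: energy_def sum.distrib sum_weight_left sum_weight_right flip: sum_distrib_left mult_2)
    also have "\<dots> \<le> (1 / 2 + \<theta> / 4) * (2 * R) + (1 / (2 * \<theta>)) * (2 * (2 * s\<^sup>2 / R))"
      unfolding R(1) using approx \<theta> by (intro add_left_mono mult_left_mono) auto
    also have "\<dots> = R + 2 * s"
      using R(2) \<open>s > 0\<close> by (simp add: \<theta>_def power2_eq_square field_simps)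
    finally show ?thesis by (intro mult_left_mono) auto
  qed
  finally show ?thesis .
qed

text \<open>The bound on \<open>s\<close> is strict because \<open>2 * k\<close> bands of mass
  \<open>C\<close> would give only the weak inequality
  \<open>?l \<le> 2 * R\<^sup>2 / s\<^sup>2\<close>; strictness turns this into a
  contradiction.\<close>

lemma improved_cheeger:
  assumes k: "k \<in> {1..CARD('v)}"
    and R: "R = eigval (signed_laplacian E w \<sigma>) 1" "R > 0"
    and s: "s > sqrt 2 * R / sqrt (eigval (signed_laplacian E w \<sigma>) k)"
  shows "signed_cheeger E w \<sigma> (wdegree w) \<le> 4 * real k * R + 8 * real k * s"
proof -
  let ?l = "eigval (signed_laplacian E w \<sigma>) k"
  have l: "?l > 0" using eigval_first_le[OF k] R by simp
  have k0: "real k > 0" using k by simp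
  have s0: "s > 0"
  proof -
    have "0 \<le> sqrt 2 * R / sqrt ?l" using R(2) l by simp
    then show ?thesis using s by linarith
  qed
  obtain f where norm: "(\<Sum>u\<in>UNIV. wdegree w u * (f u)\<^sup>2) = 1" and en: "energy f = 2 * R"
    using first_eigenfunction R(1) by metis
  \<comment> \<open>Chosen so that \<open>energy f / (real k * C)\<close> equals
    \<open>2 * R\<^sup>2 / s\<^sup>2\<close>, which lies below \<open>?l\<close>, while
    \<open>2 * k\<close> bands have total mass at most \<open>2 * s\<^sup>2 / R\<close>.\<close>
  define C where "C = s\<^sup>2 / (R * real k)"
  have C: "C > 0" using s0 R k0 by (simp add: C_def)
  define m where "m a b = (\<Sum>u\<in>UNIV. wdegree w u * (tent a b (f u))\<^sup>2)" for a b
  define M where "M = Max (range (\<lambda>u. \<bar>f u\<bar>))"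
  have "continuous_on UNIV (m a)" for a
    unfolding m_def tent_def by (intro continuous_intros)
  moreover have "m a a = 0" for a
  proof -
    have "tent a a x = 0" for x using tent_nonzero_iff[of a a x] by linarith
    then show ?thesis by (simp add: m_def)
  qed
  ultimately obtain t where t: "mono t" "t 0 = 0"
    and alt: "(\<forall>i<2 * k. m (t i) (t (Suc i)) = C)
      \<or> (M \<le> t (2 * k) \<and> (\<forall>i<2 * k. m (t i) (t (Suc i)) \<le> C))"
    using ex_thresholds[of m C "2 * k" M] C by blast
  have "\<not> (\<forall>i<2 * k. m (t i) (t (Suc i)) = C)"
  proof
    assume "\<forall>i<2 * k. m (t i) (t (Suc i)) = C"
    then have "?l \<le> energy f / (real k * C)"
      unfolding m_def by (intro eigval_le_of_tent_masses[OF k t C]) auto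
    also have "\<dots> = 2 * R\<^sup>2 / s\<^sup>2"
      using k0 R s0 by (simp add: en C_def power2_eq_square field_simps)
    finally have "?l * s\<^sup>2 \<le> 2 * R\<^sup>2"
      using s0 by (simp add: field_simps)
    moreover have "(sqrt 2 * R)\<^sup>2 < (s * sqrt ?l)\<^sup>2"
      using s l R(2) by (intro power_strict_mono) (auto simp: field_simps)
    ultimately show False using l by (simp add: power_mult_distrib mult.commute)
  qed
  with alt have M: "M \<le> t (2 * k)" and mass: "\<And>i. i < 2 * k \<Longrightarrow> m (t i) (t (Suc i)) \<le> C"
    by auto
  have "signed_cheeger E w \<sigma> (wdegree w) \<le> 4 * real (2 * k) * (R / 2 + s)"
  proof (rule signed_cheeger_le_of_step_approximation[OF t _ norm en R(2) s0])
    show "\<bar>f u\<bar> \<le> t (2 * k)" for u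
    proof -
      have "\<bar>f u\<bar> \<le> M" unfolding M_def by (intro Max_ge) auto
      then show ?thesis using M by simp
    qed
    have "(\<Sum>u\<in>UNIV. wdegree w u * (step_dist t (2 * k) (f u))\<^sup>2)
        = (\<Sum>i<2 * k. m (t i) (t (Suc i)))"
      unfolding m_def step_dist_square[OF t(1)] sum_distrib_left by (rule sum.swap)
    also have "\<dots> \<le> (\<Sum>i<2 * k. C)"
      using mass by (intro sum_mono) auto
    also have "\<dots> = 2 * s\<^sup>2 / R"
      using k0 R(2) by (simp add: C_def)
    finally show "(\<Sum>u\<in>UNIV. wdegree w u * (step_dist t (2 * k) (f u))\<^sup>2) \<le> 2 * s\<^sup>2 / R" .
  qed
  then show ?thesis by (simp add: algebra_simps)
qed

text \<open>Zero energy forces \<open>f u = edge_sign u v * f v\<close> along every edge, so the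
  right side of the linear Cheeger bound vanishes. This case is separate because the main estimate
  divides by the first eigenvalue.\<close>

lemma signed_cheeger_eq_0:
  assumes "eigval (signed_laplacian E w \<sigma>) 1 = 0"
  shows "signed_cheeger E w \<sigma> (wdegree w) = 0"
proof -
  obtain f where norm: "(\<Sum>u\<in>UNIV. wdegree w u * (f u)\<^sup>2) = 1" and en: "energy f = 0"
    using first_eigenfunction assms by auto
  have nn: "w u v * (f u - edge_sign u v * f v)\<^sup>2 \<ge> 0" for u v
    using weight_nonneg by simp
  have "w u v * \<bar>f u - edge_sign u v * f v\<bar> = 0" for u v
  proof -
    have "(\<Sum>v\<in>UNIV. w u v * (f u - edge_sign u v * f v)\<^sup>2) = 0"
      using en nn unfolding energy_def by (subst (asm) sum_nonneg_eq_0_iff) (auto intro: sum_nonneg)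
    then have "w u v * (f u - edge_sign u v * f v)\<^sup>2 = 0"
      using nn by (subst (asm) sum_nonneg_eq_0_iff) auto
    then show ?thesis by auto
  qed
  then have "(\<Sum>u\<in>UNIV. \<Sum>v\<in>UNIV. w u v * \<bar>f u - edge_sign u v * f v\<bar>) = 0"
    by (intro sum.neutral ballI)
  then have le: "signed_cheeger E w \<sigma> (wdegree w) * (\<Sum>u\<in>UNIV. wdegree w u * \<bar>f u\<bar>) \<le> 0"
    using signed_cheeger_mult_abs_le[of f] by simp
  have "\<exists>u. f u \<noteq> 0"
  proof (rule ccontr)
    assume "\<not> ?thesis"
    then show False using norm by simp
  qed
  then obtain u where "f u \<noteq> 0" by blast
  then have "(\<Sum>u\<in>UNIV. wdegree w u * \<bar>f u\<bar>) > 0"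
    using wdegree_pos by (intro sum_pos2[of _ u]) (simp_all add: less_imp_le)
  with le have "signed_cheeger E w \<sigma> (wdegree w) \<le> 0"
    by (simp add: mult_le_0_iff)
  with signed_cheeger_nonneg show ?thesis by simp
qed

end

theorem theorem6p1:
  fixes E :: "'v::finite set set"
    and w :: "'v \<Rightarrow> 'v \<Rightarrow> real"
    and \<sigma> :: "'v set \<Rightarrow> int"
    and k :: nat
  assumes "signed_graph E w \<sigma>"
    and "k \<in> {1..CARD('v)}"
  shows "signed_cheeger E w \<sigma> (wdegree w) \<le> 8 * real k * eigval (signed_laplacian E w \<sigma>) 1
    \<or> signed_cheeger E w \<sigma> (wdegree w)
        < 16 * sqrt 2 * real k
          * (eigval (signed_laplacian E w \<sigma>) 1 / sqrt (eigval (signed_laplacian E w \<sigma>) k))"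
proof -
  interpret signed_graph E w \<sigma> by (rule assms(1))
  let ?h = "signed_cheeger E w \<sigma> (wdegree w)"
  define R where "R = eigval (signed_laplacian E w \<sigma>) 1"
  define q where "q = sqrt 2 * R / sqrt (eigval (signed_laplacian E w \<sigma>) k)"
  have k: "real k > 0" using assms(2) by simp
  have "R \<ge> 0"
    using first_eigenfunction energy_nonneg by (metis R_def mult_le_cancel_left_pos mult_zero_right zero_less_numeral)
  \<comment> \<open>For \<open>R = 0\<close> the first alternative holds as an equality; the k-th
    eigenvalue may then vanish too, so the quotient in the second is avoided.\<close>
  then consider "R = 0" | "R > 0" by linarith
  then show ?thesis
  proof cases
    case 1
    then show ?thesis using signed_cheeger_eq_0 by (simp add: R_def)
  next
    case 2
    have "?h \<le> 8 * real k * R \<or> ?h < 16 * real k * q"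
    proof (rule ccontr)
      assume "\<not> ?thesis"
      \<comment> \<open>The average of the two failed bounds \<open>8 * real k * R\<close> and
        \<open>16 * real k * q\<close> lies strictly below \<open>?h\<close>. This gap leaves room
        for an \<open>s\<close> above \<open>q\<close>, as \<open>improved_cheeger\<close>
        demands.\<close>
      then have "4 * real k * R + 8 * real k * q < ?h" by linarith
      then have "q < (?h - 4 * real k * R) / (8 * real k)"
        using k by (simp add: field_simps)
      then obtain s where s: "q < s" "s < (?h - 4 * real k * R) / (8 * real k)"
        using dense by blast
      then have "4 * real k * R + 8 * real k * s < ?h"
        using k by (simp add: field_simps)
      moreover have "?h \<le> 4 * real k * R + 8 * real k * s"
        using improved_cheeger[OF assms(2) R_def 2] s(1) by (simp add: q_def)
      ultimately show False by linarith
    qed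
    moreover have "16 * real k * q
      = 16 * sqrt 2 * real k * (R / sqrt (eigval (signed_laplacian E w \<sigma>) k))"
      by (simp add: q_def)
    ultimately show ?thesis by (simp add: R_def)
  qed
qed

end
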